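(* Let $\Omega\subset\mathbb R^n$ be a Borel set, let $x\in\hat\Omega$, let $f\in L^1_{\rm loc}(\Omega,\mathbb R^m)$, and let $\alpha\in\mathbb R^m$. Then $f$ is essentially differentiable at $x$ with $D_{\rm es}f(x)=L$ and with $\alpha$ if and only if $L:\mathbb R^n\to\mathbb R^m$ is a linear map such that for any $E\in\mathcal B(\Omega)$ with $$\mathcal L^n(B_\delta(x)\cap E)>0\qquad\text{for all }\delta>0$$ there is an $\mathcal L^n$-density $\mathrm{dens}_x^E\in\mathcal L^n\text{-}\mathrm{Dens}_x^E$ at $x$ within $E$ satisfying $$\int_\Omega\frac{|f(y)-\alpha-L(y-x)|}{|y-x|}\,d\,\mathrm{dens}_x^E(y)=0 .$$ If $f$ is essentially differentiable at $x$ with $\alpha$, then $$\alpha=\operatorname*{ess\,lim}_{y\to x}f(y)=\operatorname*{ap\,lim}_{y\to x}f(y)=\mathrm{pr}f(x)=f^\star(x)=\int_\Omega f\,d\,\mathrm{dens}_x\qquad\text{for any }\mathrm{dens}_x\in\mathrm{Dens}_x ,$$ $f$ is also approximately differentiable at $x$ with $D_{\rm ap}f(x)=D_{\rm es}f(x)$, and there is some $\delta>0$ such that $$f\in L^\infty(B_\delta(x)\cap\Omega)\quad\text{and}\quad\mathrm{pr}f\text{ exists as integral on }B_\delta(x)\cap\hat\Omega .$$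
   Context: $\mathcal L^n$ is Lebesgue measure, $\mathcal B(\Omega)$ the Borel subsets of $\Omega$. $L^1_{\rm loc}(\Omega,\mathbb R^m)$ is the usual space of classes of $\mathcal L^n$-a.e. equal locally Lebesgue integrable functions. $\mathrm{ba}(\Omega,\mathcal B(\Omega),\mathcal L^n)$ is the space of bounded finitely additive set functions $\mu:\mathcal B(\Omega)\to\mathbb R$ with $\mu(A)=0$ whenever $\mathcal L^n(A)=0$. Integral: for $\mu\ge0$ in this space put $\mu^*(A)=\inf\{\mu(B):A\subset B\in\mathcal B(\Omega)\}$. A function $g:\Omega\to\mathbb R$ is $\mu$-integrable if there are Borel step functions $h_k$ with $\mu^*(\{|h_k-g|>\varepsilon\})\to0$ for all $\varepsilon>0$ and $\int_\Omega|h_k-h_l|\,d\mu\to0$; then $\int_\Omega g\,d\mu=\lim_k\int_\Omega h_k\,d\mu$. This depends only on the $\mathcal L^n$-a.e. class of $g$; vector functions are treated componentwise. An equality for an integral includes integrability. $\hat\Omega:=\{x\in\overline\Omega:\mathcal L^n(\Omega\cap B_\delta(x))>0\ \forall\delta>0\}$. For $x\in\hat\Omega$: $\mathrm{Dens}_x$ is the set of $\mu\in\mathrm{ba}(\Omega,\mathcal B(\Omega),\mathcal L^n)$ with $\mu\ge0$ and $\mu(B_\delta(x)\cap\Omega)=\mu(\Omega)=1$ for all $\delta>0$. For $E\in\mathcal B(\Omega)$ with $\mathcal L^n(B_\delta(x)\cap E)>0$ for all $\delta>0$, $\mathcal L^n\text{-}\mathrm{Dens}_x^E$ is the set of all $\mu\in\mathrm{ba}(\Omega,\mathcal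 B(\Omega),\mathcal L^n)$ with $$\liminf_{\delta\downarrow0}\frac{\mathcal L^n(A\cap E\cap B_\delta(x))}{\mathcal L^n(E\cap B_\delta(x))}\le\mu(A)\le\limsup_{\delta\downarrow0}\frac{\mathcal L^n(A\cap E\cap B_\delta(x))}{\mathcal L^n(E\cap B_\delta(x))}\quad\forall A\in\mathcal B(\Omega).$$ Precise representatives at $y\in\hat\Omega$: $f^\star(y)=\lim_{\delta\downarrow0}\frac1{\mathcal L^n(B_\delta(y)\cap\Omega)}\int_{B_\delta(y)\cap\Omega}f\,d\mathcal L^n$ if the limit exists; $\mathrm{pr}f(y)=\int_\Omega f\,d\,\mathrm{dens}_y^\Omega$ for some $\mathrm{dens}_y^\Omega\in\mathcal L^n\text{-}\mathrm{Dens}_y^\Omega$. "$\mathrm{pr}f$ exists as integral on a set" means that at each point $y$ of the set this integral exists for at least one $\mathrm{dens}_y^\Omega\in\mathcal L^n\text{-}\mathrm{Dens}_y^\Omega$. Limits: $\operatorname{ess\,lim}_{y\to x}g(y)=\beta$ means $\lim_{\delta\downarrow0}\operatorname{ess\,sup}_{B_\delta(x)\cap\Omega}|g-\beta|=0$. $\operatorname{ap\,lim}_{y\to x}g(y)=\beta$ means $\lim_{\delta\downarrow0}\frac{\mathcal L^n(B_\delta(x)\cap\Omega\cap\{|g-\beta|\ge\varepsilon\})}{\mathcal L^n(B_\delta(x)\cap\Omega)}=0$ for all $\varepsilon>0$. The function $f$ is essentially (resp. approximately) differentiable at $x$ with $\alpha$ and with derivative $D_{\rm es}f(x):=L$ (resp.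 $D_{\rm ap}f(x):=L$), $L:\mathbb R^n\to\mathbb R^m$ linear, if $\frac{f(y)-\alpha-L(y-x)}{|y-x|}$ has essential (resp. approximate) limit $0$ as $y\to x$. *)

theory Defs
  imports "HOL-Analysis.Analysis" "HOL-Probability.Essential_Supremum"
begin

text \<open>
  Conventions. Functions on \<open>\<Omega>\<close> are total functions of which only the values on \<open>\<Omega>\<close> matter,
  and set functions on the Borel subsets of \<open>\<Omega>\<close> are total functions on sets of which only
  the values on \<open>borel_subsets \<Omega>\<close> matter. Elements of function spaces are represented by
  functions instead of classes of almost everywhere equal functions; all notions below are invariant
  under changes of the function on a Lebesgue null set. \<open>B\<^sub>\<delta>(x)\<close> is the open ball.
\<close>

definition borel_subsets :: "'a::topological_space set \<Rightarrow> 'a set set" where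
  "borel_subsets \<Omega> = {A. A \<in> sets borel \<and> A \<subseteq> \<Omega>}"

definition ba :: "'a::euclidean_space set \<Rightarrow> ('a set \<Rightarrow> real) set" where
  "ba \<Omega> = {\<mu>. (\<exists>C. \<forall>A\<in>borel_subsets \<Omega>. \<bar>\<mu> A\<bar> \<le> C) \<and>
              Measure_Space.additive (borel_subsets \<Omega>) \<mu> \<and>
              (\<forall>A\<in>borel_subsets \<Omega>. emeasure lebesgue A = 0 \<longrightarrow> \<mu> A = 0)}"

subsection \<open>Integration with respect to nonnegative finitely additive set functions\<close>

definition outer :: "'a::topological_space set \<Rightarrow> ('a set \<Rightarrow> real) \<Rightarrow> 'a set \<Rightarrow> real" where
  "outer \<Omega> \<mu> A = Inf {\<mu> B | B. B \<in> borel_subsets \<Omega> \<and> A \<subseteq> B}"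

definition borel_step :: "'a::topological_space set \<Rightarrow> ('a \<Rightarrow> real) \<Rightarrow> bool" where
  "borel_step \<Omega> h \<longleftrightarrow> simple_function (restrict_space borel \<Omega>) h"

definition step_integral ::
    "'a::topological_space set \<Rightarrow> ('a set \<Rightarrow> real) \<Rightarrow> ('a \<Rightarrow> real) \<Rightarrow> real" where
  "step_integral \<Omega> \<mu> h = (\<Sum>c\<in>h ` \<Omega>. c * \<mu> {y \<in> \<Omega>. h y = c})"

text \<open>\<open>fa_has_integral \<Omega> \<mu> g I\<close> means that \<open>g\<close> is \<open>\<mu>\<close>-integrable on \<open>\<Omega>\<close> with integral \<open>I\<close>;
  it is meant for nonnegative \<open>\<mu>\<close> only.\<close>

definition fa_has_integral ::
    "'a::topological_space set \<Rightarrow> ('a set \<Rightarrow> real) \<Rightarrow> ('a \<Rightarrow> real) \<Rightarrow> real \<Rightarrow> bool" where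
  "fa_has_integral \<Omega> \<mu> g I \<longleftrightarrow>
     (\<exists>h :: nat \<Rightarrow> 'a \<Rightarrow> real.
        (\<forall>k. borel_step \<Omega> (h k)) \<and>
        (\<forall>\<epsilon>>0. (\<lambda>k. outer \<Omega> \<mu> {y \<in> \<Omega>. \<bar>h k y - g y\<bar> > \<epsilon>}) \<longlonglongrightarrow> 0) \<and>
        ((\<lambda>(k, l). step_integral \<Omega> \<mu> (\<lambda>y. \<bar>h k y - h l y\<bar>)) \<longlongrightarrow> 0)
           (sequentially \<times>\<^sub>F sequentially) \<and>
        (\<lambda>k. step_integral \<Omega> \<mu> (h k)) \<longlonglongrightarrow> I)"

definition fa_has_vec_integral ::
    "'a::topological_space set \<Rightarrow> ('a set \<Rightarrow> real) \<Rightarrow> ('a \<Rightarrow> real^'m) \<Rightarrow> real^'m \<Rightarrow> bool" where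
  "fa_has_vec_integral \<Omega> \<mu> g I \<longleftrightarrow> (\<forall>i. fa_has_integral \<Omega> \<mu> (\<lambda>y. g y $ i) (I $ i))"

subsection \<open>Densities\<close>

definition hat :: "'a::euclidean_space set \<Rightarrow> 'a set" where
  "hat \<Omega> = {x \<in> closure \<Omega>. \<forall>\<delta>>0. emeasure lebesgue (\<Omega> \<inter> ball x \<delta>) > 0}"

definition Dens :: "'a::euclidean_space set \<Rightarrow> 'a \<Rightarrow> ('a set \<Rightarrow> real) set" where
  "Dens \<Omega> x = {\<mu> \<in> ba \<Omega>. (\<forall>A\<in>borel_subsets \<Omega>. 0 \<le> \<mu> A) \<and>
                 (\<forall>\<delta>>0. \<mu> (ball x \<delta> \<inter> \<Omega>) = \<mu> \<Omega> \<and> \<mu> \<Omega> = 1)}"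

text \<open>\<open>Leb_Dens \<Omega> E x\<close> is \<open>\<L>\<^sup>n-Dens\<^sub>x\<^sup>E\<close>; it is meant for Borel sets \<open>E \<subseteq> \<Omega>\<close> with
  positive measure in each ball around \<open>x\<close>. The lower and the upper limit are taken in \<open>ereal\<close>,
  since \<open>real\<close> is not a complete lattice.\<close>

definition Leb_Dens :: "'a::euclidean_space set \<Rightarrow> 'a set \<Rightarrow> 'a \<Rightarrow> ('a set \<Rightarrow> real) set" where
  "Leb_Dens \<Omega> E x = {\<mu> \<in> ba \<Omega>. \<forall>A\<in>borel_subsets \<Omega>.
      Liminf (at_right 0)
        (\<lambda>\<delta>. ereal (measure lebesgue (A \<inter> E \<inter> ball x \<delta>) / measure lebesgue (E \<inter> ball x \<delta>)))
        \<le> ereal (\<mu> A) \<and>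
      ereal (\<mu> A) \<le> Limsup (at_right 0)
        (\<lambda>\<delta>. ereal (measure lebesgue (A \<inter> E \<inter> ball x \<delta>) / measure lebesgue (E \<inter> ball x \<delta>)))}"

subsection \<open>Function spaces\<close>

definition L1_loc :: "'a::euclidean_space set \<Rightarrow> ('a \<Rightarrow> 'b::euclidean_space) set" where
  "L1_loc \<Omega> = {f \<in> borel_measurable (lebesgue_on \<Omega>).
                 \<forall>K. compact K \<and> K \<subseteq> \<Omega> \<longrightarrow> set_integrable lebesgue K f}"

definition L_infty :: "'a::euclidean_space set \<Rightarrow> ('a \<Rightarrow> 'b::euclidean_space) set" where
  "L_infty S = {f \<in> borel_measurable (lebesgue_on S).
                  esssup (lebesgue_on S) (\<lambda>y. ereal (norm (f y))) < \<infinity>}"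

subsection \<open>Precise representatives\<close>

text \<open>The Bochner integral of a nonintegrable function is \<open>0\<close> by convention, hence the first clause.\<close>

definition has_fstar ::
    "'a::euclidean_space set \<Rightarrow> ('a \<Rightarrow> 'b::euclidean_space) \<Rightarrow> 'a \<Rightarrow> 'b \<Rightarrow> bool" where
  "has_fstar \<Omega> f y v \<longleftrightarrow>
     (\<forall>\<^sub>F \<delta> in at_right 0. set_integrable lebesgue (ball y \<delta> \<inter> \<Omega>) f) \<and>
     ((\<lambda>\<delta>. (1 / measure lebesgue (ball y \<delta> \<inter> \<Omega>)) *\<^sub>R
            set_lebesgue_integral lebesgue (ball y \<delta> \<inter> \<Omega>) f) \<longlongrightarrow> v) (at_right 0)"

text \<open>\<open>pr f(y)\<close> depends on the choice of a density, so \<open>has_pr \<Omega> f y v\<close> says that \<open>v\<close> is a value of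
  \<open>pr f\<close> at \<open>y\<close> for some choice.\<close>

definition has_pr ::
    "'a::euclidean_space set \<Rightarrow> ('a \<Rightarrow> real^'m) \<Rightarrow> 'a \<Rightarrow> real^'m \<Rightarrow> bool" where
  "has_pr \<Omega> f y v \<longleftrightarrow> (\<exists>\<mu>\<in>Leb_Dens \<Omega> \<Omega> y. fa_has_vec_integral \<Omega> \<mu> f v)"

definition pr_exists_on ::
    "'a::euclidean_space set \<Rightarrow> ('a \<Rightarrow> real^'m) \<Rightarrow> 'a set \<Rightarrow> bool" where
  "pr_exists_on \<Omega> f S \<longleftrightarrow> (\<forall>y\<in>S. \<exists>v. has_pr \<Omega> f y v)"

subsection \<open>Essential and approximate limits and derivatives\<close>

definition has_ess_lim ::
    "'a::euclidean_space set \<Rightarrow> ('a \<Rightarrow> 'b::euclidean_space) \<Rightarrow> 'a \<Rightarrow> 'b \<Rightarrow> bool" where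
  "has_ess_lim \<Omega> g x \<beta> \<longleftrightarrow>
     ((\<lambda>\<delta>. esssup (lebesgue_on (ball x \<delta> \<inter> \<Omega>)) (\<lambda>y. ereal (norm (g y - \<beta>)))) \<longlongrightarrow> 0) (at_right 0)"

definition has_ap_lim ::
    "'a::euclidean_space set \<Rightarrow> ('a \<Rightarrow> 'b::euclidean_space) \<Rightarrow> 'a \<Rightarrow> 'b \<Rightarrow> bool" where
  "has_ap_lim \<Omega> g x \<beta> \<longleftrightarrow>
     (\<forall>\<epsilon>>0. ((\<lambda>\<delta>. measure lebesgue (ball x \<delta> \<inter> \<Omega> \<inter> {y. norm (g y - \<beta>) \<ge> \<epsilon>})
                   / measure lebesgue (ball x \<delta> \<inter> \<Omega>)) \<longlongrightarrow> 0) (at_right 0))"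

text \<open>\<open>has_ess_deriv \<Omega> f x \<alpha> L\<close>: \<open>f\<close> is essentially differentiable at \<open>x\<close> with \<open>\<alpha>\<close> and with derivative
  \<open>L\<close>, and similarly for \<open>has_ap_deriv\<close>. These are relations since the derivative need not be unique
  if \<open>\<Omega>\<close> is very thin near \<open>x\<close>. The value of the quotients at \<open>y = x\<close> is irrelevant.\<close>

definition has_ess_deriv ::
    "'a::euclidean_space set \<Rightarrow> ('a \<Rightarrow> 'b::euclidean_space) \<Rightarrow> 'a \<Rightarrow> 'b \<Rightarrow> ('a \<Rightarrow> 'b) \<Rightarrow> bool" where
  "has_ess_deriv \<Omega> f x \<alpha> L \<longleftrightarrow>
     linear L \<and> has_ess_lim \<Omega> (\<lambda>y. (f y - \<alpha> - L (y - x)) /\<^sub>R norm (y - x)) x 0"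

definition has_ap_deriv ::
    "'a::euclidean_space set \<Rightarrow> ('a \<Rightarrow> 'b::euclidean_space) \<Rightarrow> 'a \<Rightarrow> 'b \<Rightarrow> ('a \<Rightarrow> 'b) \<Rightarrow> bool" where
  "has_ap_deriv \<Omega> f x \<alpha> L \<longleftrightarrow>
     linear L \<and> has_ap_lim \<Omega> (\<lambda>y. (f y - \<alpha> - L (y - x)) /\<^sub>R norm (y - x)) x 0"

end

(* Both directions rest on the fact that a density at x is a finitely additive probability carried by
   every ball around x. If g has the essential limit b at x, then g is within any epsilon of b off a
   density-null set, so constant step functions already compute the integral of g as b. Conversely, if
   the difference quotient exceeds epsilon on a set of positive measure in every ball around x, then a
   density within a Borel kernel E of that set gives E full mass, and its integral over the quotient is
   positive. Densities exist because the mean proportions in balls, as functions of the radius with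
   values in a product of unit intervals, have a cluster point. *)

theory Submission
  imports Defs
begin

section \<open>Nonnegative finitely additive set functions\<close>

text \<open>Without countable additivity, pointwise convergence gives no control of integrals, so
  every integral is handled through an approximating sequence of step functions. That sequence is
  close to \<open>g\<close> only in \<open>\<mu>\<close>-measure and Cauchy in mean, hence a lower
  bound for \<open>g\<close> does not pass pointwise to it, and positivity of the integral needs its
  own argument. A second obstacle is that the set functions live on Borel sets while
  \<open>f\<close> is only Lebesgue measurable: exceptional sets are enlarged, and superlevel sets
  shrunk, to Borel sets at the cost of a null set. The existence of \<open>pr f\<close> near
  \<open>x\<close> lies outside the scheme of essential limits, since at those points
  \<open>f\<close> is only known to be bounded; it rests on the integrability of bounded measurable
  functions. For the existence of densities, one filter has to serve all sets at once: limits along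
  it are additive, whereas lower and upper limits are not.\<close>

locale nonneg_ba =
  fixes \<Omega> :: "'a::euclidean_space set" and \<mu> :: "'a set \<Rightarrow> real"
  assumes borel_space: "\<Omega> \<in> sets borel"
    and ba: "\<mu> \<in> ba \<Omega>"
    and nonneg: "A \<in> borel_subsets \<Omega> \<Longrightarrow> 0 \<le> \<mu> A"
begin

lemma space_in: "\<Omega> \<in> borel_subsets \<Omega>"
  using borel_space by (simp add: borel_subsets_def)

lemma Un_in: "A \<in> borel_subsets \<Omega> \<Longrightarrow> B \<in> borel_subsets \<Omega> \<Longrightarrow> A \<union> B \<in> borel_subsets \<Omega>"
  and Diff_in: "A \<in> borel_subsets \<Omega> \<Longrightarrow> B \<in> borel_subsets \<Omega> \<Longrightarrow> A - B \<in> borel_subsets \<Omega>"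
  by (auto simp: borel_subsets_def)

lemma additive:
  "A \<in> borel_subsets \<Omega> \<Longrightarrow> B \<in> borel_subsets \<Omega> \<Longrightarrow> A \<inter> B = {} \<Longrightarrow> \<mu> (A \<union> B) = \<mu> A + \<mu> B"
  using ba by (simp add: ba_def Measure_Space.additive_def)

lemma null: "A \<in> borel_subsets \<Omega> \<Longrightarrow> emeasure lebesgue A = 0 \<Longrightarrow> \<mu> A = 0"
  using ba by (simp add: ba_def)

lemma measure_empty: "\<mu> {} = 0"
  by (rule null) (auto simp: borel_subsets_def)

lemma mono:
  assumes "A \<in> borel_subsets \<Omega>" "B \<in> borel_subsets \<Omega>" "A \<subseteq> B"
  shows "\<mu> A \<le> \<mu> B"
proof -
  have "\<mu> (A \<union> (B - A)) = \<mu> A + \<mu> (B - A)"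
    using assms by (intro additive Diff_in) auto
  moreover have "A \<union> (B - A) = B" using assms by auto
  ultimately show ?thesis
    using nonneg[OF Diff_in[OF assms(2,1)]] by simp
qed

lemma compl: "A \<in> borel_subsets \<Omega> \<Longrightarrow> \<mu> (\<Omega> - A) = \<mu> \<Omega> - \<mu> A"
  using additive[of A "\<Omega> - A"] Diff_in[OF space_in, of A]
  by (auto simp: borel_subsets_def Un_absorb1)

lemma subadditive:
  assumes "A \<in> borel_subsets \<Omega>" "B \<in> borel_subsets \<Omega>"
  shows "\<mu> (A \<union> B) \<le> \<mu> A + \<mu> B"
proof -
  have "\<mu> (A \<union> (B - A)) = \<mu> A + \<mu> (B - A)"
    using assms by (intro additive Diff_in) auto
  moreover have "\<mu> (B - A) \<le> \<mu> B"
    using assms by (intro mono Diff_in) auto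
  ultimately show ?thesis by simp
qed

lemma finite_additive:
  assumes "finite I" "\<And>i. i \<in> I \<Longrightarrow> A i \<in> borel_subsets \<Omega>" "disjoint_family_on A I"
  shows "\<mu> (\<Union>i\<in>I. A i) = (\<Sum>i\<in>I. \<mu> (A i)) \<and> (\<Union>i\<in>I. A i) \<in> borel_subsets \<Omega>"
  using assms
proof (induction I rule: finite_induct)
  case empty
  then show ?case using measure_empty by (auto simp: borel_subsets_def)
next
  case (insert i I)
  have IH: "\<mu> (\<Union>i\<in>I. A i) = (\<Sum>i\<in>I. \<mu> (A i))" "(\<Union>i\<in>I. A i) \<in> borel_subsets \<Omega>"
    using insert.IH insert.prems by (auto simp: disjoint_family_on_def)
  have "A i \<inter> (\<Union>i\<in>I. A i) = {}"
    using insert.prems(2) insert.hyps(2) by (force simp: disjoint_family_on_def)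
  then show ?case
    using IH insert additive[of "A i" "\<Union>i\<in>I. A i"] Un_in[of "A i" "\<Union>i\<in>I. A i"] by simp
qed

subsection \<open>Outer extension\<close>

lemma outer_le: "B \<in> borel_subsets \<Omega> \<Longrightarrow> A \<subseteq> B \<Longrightarrow> outer \<Omega> \<mu> A \<le> \<mu> B"
  unfolding outer_def by (intro cInf_lower bdd_belowI[of _ 0]) (auto intro: nonneg)

lemma outer_nonneg: "A \<subseteq> \<Omega> \<Longrightarrow> 0 \<le> outer \<Omega> \<mu> A"
  unfolding outer_def by (rule cInf_greatest) (use space_in in \<open>auto intro: nonneg\<close>)

lemma outer_eq_0: "B \<in> borel_subsets \<Omega> \<Longrightarrow> A \<subseteq> B \<Longrightarrow> \<mu> B = 0 \<Longrightarrow> outer \<Omega> \<mu> A = 0"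
  using outer_le[of B A] outer_nonneg[of A] by (force simp: borel_subsets_def)

lemma outer_less:
  assumes "outer \<Omega> \<mu> A < e" "A \<subseteq> \<Omega>"
  obtains B where "B \<in> borel_subsets \<Omega>" "A \<subseteq> B" "\<mu> B < e"
proof -
  have "{\<mu> B | B. B \<in> borel_subsets \<Omega> \<and> A \<subseteq> B} \<noteq> {}"
    using space_in assms by auto
  then have "\<exists>b\<in>{\<mu> B | B. B \<in> borel_subsets \<Omega> \<and> A \<subseteq> B}. b < e"
    using assms(1) unfolding outer_def by (intro cInf_lessD) auto
  then show ?thesis using that by blast
qed

text \<open>The exceptional set of a Lebesgue almost everywhere statement need not be Borel, and
  then \<open>\<mu>\<close> says nothing about it. The completion encloses it in a Borel null set,
  which \<open>\<mu>\<close> ignores.\<close>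

lemma AE_cover:
  assumes "AE y in lebesgue. P y"
  obtains N where "N \<in> borel_subsets \<Omega>" "\<mu> N = 0" "\<And>y. y \<in> \<Omega> - N \<Longrightarrow> P y"
proof -
  obtain N where N: "N \<in> null_sets lborel" "{y. \<not> P y} \<subseteq> N"
    using assms by (auto simp: AE_completion_iff eventually_ae_filter[of _ lborel])
  then have "N \<inter> \<Omega> \<in> null_sets lborel"
    using borel_space by (intro null_set_Int2) auto
  then have "\<mu> (N \<inter> \<Omega>) = 0"
    using N borel_space by (intro null) (auto simp: borel_subsets_def null_sets_def)
  with N borel_space show ?thesis
    by (intro that[of "N \<inter> \<Omega>"]) (auto simp: borel_subsets_def)
qed

subsection \<open>Integrals of step functions\<close>

lemma step_fibre:
  assumes "simple_function (restrict_space borel \<Omega>) p"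
  shows "{y \<in> \<Omega>. p y = c} \<in> borel_subsets \<Omega>"
proof -
  have "p -` {c} \<inter> \<Omega> \<in> sets (restrict_space borel \<Omega>)"
    using simple_functionD(2)[OF assms, of "{c}"] by (simp add: space_restrict_space)
  moreover have "p -` {c} \<inter> \<Omega> = {y \<in> \<Omega>. p y = c}" by auto
  ultimately show ?thesis
    using borel_space by (auto simp: borel_subsets_def sets_restrict_space_iff)
qed

lemma step_range: "simple_function (restrict_space borel \<Omega>) p \<Longrightarrow> finite (p ` \<Omega>)"
  using simple_functionD(1) by (fastforce simp: space_restrict_space)

lemma sum_fibres:
  assumes p: "simple_function (restrict_space borel \<Omega>) p" and S: "finite S"
  shows "(\<Sum>c\<in>S. \<mu> {y \<in> \<Omega>. p y = c}) = \<mu> {y \<in> \<Omega>. p y \<in> S}"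
proof -
  have "{y \<in> \<Omega>. p y \<in> S} = (\<Union>c\<in>S. {y \<in> \<Omega>. p y = c})" by auto
  then show ?thesis
    using finite_additive[of S "\<lambda>c. {y \<in> \<Omega>. p y = c}"] step_fibre[OF p] S
    by (simp add: disjoint_family_on_def disjoint_iff)
qed

text \<open>Replaces common refinements: for \<open>p\<close> the pair of two step functions, the
  fibres of \<open>p\<close> refine those of both, and with \<open>F\<close> a projection or the sum
  all integrals become sums over the same partition.\<close>

lemma step_integral_compose:
  assumes p: "simple_function (restrict_space borel \<Omega>) p"
  shows "step_integral \<Omega> \<mu> (\<lambda>y. F (p y)) = (\<Sum>c\<in>p ` \<Omega>. F c * \<mu> {y \<in> \<Omega>. p y = c})"
proof -
  have fin: "finite (p ` \<Omega>)" by (rule step_range[OF p])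
  have "step_integral \<Omega> \<mu> (\<lambda>y. F (p y)) = (\<Sum>d\<in>F ` p ` \<Omega>. d * \<mu> {y \<in> \<Omega>. F (p y) = d})"
    by (simp add: step_integral_def image_image)
  also have "\<dots> = (\<Sum>d\<in>F ` p ` \<Omega>. \<Sum>c\<in>{c \<in> p ` \<Omega>. F c = d}. F c * \<mu> {y \<in> \<Omega>. p y = c})"
  proof (rule sum.cong[OF refl])
    fix d
    have "{y \<in> \<Omega>. F (p y) = d} = {y \<in> \<Omega>. p y \<in> {c \<in> p ` \<Omega>. F c = d}}" by auto
    then have "\<mu> {y \<in> \<Omega>. F (p y) = d} = (\<Sum>c\<in>{c \<in> p ` \<Omega>. F c = d}. \<mu> {y \<in> \<Omega>. p y = c})"
      using sum_fibres[OF p, of "{c \<in> p ` \<Omega>. F c = d}"] fin by simp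
    then show "d * \<mu> {y \<in> \<Omega>. F (p y) = d} = (\<Sum>c\<in>{c \<in> p ` \<Omega>. F c = d}. F c * \<mu> {y \<in> \<Omega>. p y = c})"
      by (simp add: sum_distrib_left)
  qed
  also have "\<dots> = (\<Sum>c\<in>p ` \<Omega>. F c * \<mu> {y \<in> \<Omega>. p y = c})"
    by (rule sum.image_gen[OF fin, symmetric])
  finally show ?thesis .
qed

lemma step_integral_add:
  assumes "borel_step \<Omega> g" "borel_step \<Omega> h"
  shows "step_integral \<Omega> \<mu> (\<lambda>y. g y + h y) = step_integral \<Omega> \<mu> g + step_integral \<Omega> \<mu> h"
proof -
  have p: "simple_function (restrict_space borel \<Omega>) (\<lambda>y. (g y, h y))"
    using assms by (simp add: borel_step_def)
  show ?thesis
    using step_integral_compose[OF p, of "\<lambda>c. fst c + snd c"]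
      step_integral_compose[OF p, of fst] step_integral_compose[OF p, of snd]
    by (simp add: sum.distrib distrib_right)
qed

lemma step_integral_mono:
  assumes "borel_step \<Omega> g" "borel_step \<Omega> h" "\<And>y. y \<in> \<Omega> \<Longrightarrow> g y \<le> h y"
  shows "step_integral \<Omega> \<mu> g \<le> step_integral \<Omega> \<mu> h"
proof -
  have p: "simple_function (restrict_space borel \<Omega>) (\<lambda>y. (g y, h y))"
    using assms by (simp add: borel_step_def)
  show ?thesis
    using step_integral_compose[OF p, of fst] step_integral_compose[OF p, of snd] assms(3)
    by (auto intro!: sum_mono mult_right_mono nonneg step_fibre[OF p])
qed

lemma step_If: "A \<in> borel_subsets \<Omega> \<Longrightarrow> borel_step \<Omega> (\<lambda>y. if y \<in> A then a else b)"
  unfolding borel_step_def using borel_space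
  by (intro simple_function_If_set)
    (auto simp: borel_subsets_def sets_restrict_space_iff space_restrict_space)

lemma step_integral_If:
  assumes A: "A \<in> borel_subsets \<Omega>"
  shows "step_integral \<Omega> \<mu> (\<lambda>y. if y \<in> A then a else b) = a * \<mu> A + b * \<mu> (\<Omega> - A)"
proof -
  \<comment> \<open>The partition comes from membership in \<open>A\<close> and not from the
    function itself, whose two fibres merge when \<open>a = b\<close>.\<close>
  have p: "simple_function (restrict_space borel \<Omega>) (\<lambda>y. y \<in> A)"
    using simple_function_compose1[OF step_If[OF A, of 1 0, unfolded borel_step_def], of "\<lambda>t. t = (1::real)"]
    by (rule simple_function_cong[THEN iffD1, rotated]) simp
  \<comment> \<open>A truth value can be missing from the image, for instance when \<open>A\<close>
    is empty or all of \<open>\<Omega>\<close>; its fibre is empty and contributes 0.\<close>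
  have "(\<Sum>c\<in>(\<lambda>y. y \<in> A) ` \<Omega>. (if c then a else b) * \<mu> {y \<in> \<Omega>. (y \<in> A) = c}) =
      (\<Sum>c\<in>UNIV. (if c then a else b) * \<mu> {y \<in> \<Omega>. (y \<in> A) = c})"
  proof (rule sum.mono_neutral_left; safe?)
    fix c assume "c \<notin> (\<lambda>y. y \<in> A) ` \<Omega>"
    then have "{y \<in> \<Omega>. (y \<in> A) = c} = {}" by auto
    then show "(if c then a else b) * \<mu> {y \<in> \<Omega>. (y \<in> A) = c} = 0"
      using measure_empty by (simp only: mult_zero_right)
  qed auto
  moreover have "{y \<in> \<Omega>. y \<in> A} = A" "{y \<in> \<Omega>. y \<notin> A} = \<Omega> - A"
    using A by (auto simp: borel_subsets_def)
  ultimately show ?thesis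
    using step_integral_compose[OF p, of "\<lambda>c. if c then a else b"] by (simp add: UNIV_bool)
qed

lemma step_integral_const: "step_integral \<Omega> \<mu> (\<lambda>y. c) = c * \<mu> \<Omega>"
  using step_integral_If[OF space_in, of c c] measure_empty by simp

lemma step_const: "borel_step \<Omega> (\<lambda>y. c)"
  by (simp add: borel_step_def)

subsection \<open>Integrability\<close>

text \<open>The constant sequence \<open>c\<close> is already an admissible approximation. The
  condition is weaker than \<open>g = c\<close> off a null set: for a density at a point, the
  distance to that point satisfies it with \<open>c = 0\<close> although it vanishes only
  there.\<close>

lemma fa_has_integral_const:
  assumes "\<And>\<epsilon>. \<epsilon> > 0 \<Longrightarrow> outer \<Omega> \<mu> {y \<in> \<Omega>. \<bar>c - g y\<bar> > \<epsilon>} = 0"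
  shows "fa_has_integral \<Omega> \<mu> g (c * \<mu> \<Omega>)"
  unfolding fa_has_integral_def
  by (rule exI[of _ "\<lambda>_ _. c"]) (auto simp: assms step_const step_integral_const case_prod_unfold)

text \<open>Rounding down to multiples of \<open>1 / (k + 1)\<close> approximates a bounded function
  uniformly by finitely many values, so the approximation in measure and the Cauchy condition are
  immediate. The value of the integral is a cluster point of the bounded sequence of step
  integrals.\<close>

lemma fa_has_integral_bounded:
  assumes g: "g \<in> borel_measurable (lebesgue_on \<Omega>)"
    and B: "B \<in> borel_subsets \<Omega>" "\<mu> (\<Omega> - B) = 0"
    and C: "AE y in lebesgue. y \<in> B \<longrightarrow> \<bar>g y\<bar> \<le> C"
  shows "\<exists>I. fa_has_integral \<Omega> \<mu> g I"
proof -
  \<comment> \<open>Step functions need Borel fibres, so \<open>g\<close> is extended by 0 and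
    replaced by a Borel function that agrees with it almost everywhere.\<close>
  have "(\<lambda>y. if y \<in> \<Omega> then g y else 0) \<in> borel_measurable lebesgue"
    using g borel_space by (subst borel_measurable_if) auto
  then obtain g' where g': "g' \<in> borel_measurable borel"
    and ae: "AE y in lebesgue. (if y \<in> \<Omega> then g y else 0) = g' y"
    using completion_ex_borel_measurable_real[of "\<lambda>y. if y \<in> \<Omega> then g y else 0" lborel]
    by (auto intro: AE_completion)
  have "AE y in lebesgue. y \<in> B \<longrightarrow> g' y = g y \<and> \<bar>g y\<bar> \<le> C"
    using ae C by eventually_elim (use B in \<open>auto simp: borel_subsets_def\<close>)
  then obtain N where N: "N \<in> borel_subsets \<Omega>" "\<mu> N = 0"
    "\<And>y. y \<in> \<Omega> - N \<Longrightarrow> y \<in> B \<longrightarrow> g' y = g y \<and> \<bar>g y\<bar> \<le> C"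
    using AE_cover by blast
  define Z where "Z = (\<Omega> - B) \<union> N"
  have Z: "Z \<in> borel_subsets \<Omega>" "\<mu> Z = 0"
  proof -
    show Zin: "Z \<in> borel_subsets \<Omega>"
      unfolding Z_def by (intro Un_in Diff_in space_in B N)
    show "\<mu> Z = 0"
      using subadditive[OF Diff_in[OF space_in B(1)] N(1)] B(2) N(2) nonneg[OF Zin]
      by (simp add: Z_def)
  qed
  \<comment> \<open>Cutting off at \<open>C\<close> makes the Borel version bounded everywhere,
    hence its roundings finitely valued; it changes nothing outside \<open>Z\<close>.\<close>
  define c where "c y = (if \<bar>g' y\<bar> \<le> C then g' y else 0)" for y
  have c_eq: "c y = g y" if "y \<in> \<Omega> - Z" for y
    using N(3)[of y] that by (auto simp: Z_def c_def)
  have c_bd: "\<bar>c y\<bar> \<le> \<bar>C\<bar>" for y by (auto simp: c_def)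
  define t :: "nat \<Rightarrow> 'a \<Rightarrow> real"
    where "t k y = of_int \<lfloor>real (k + 1) * c y\<rfloor> / real (k + 1)" for k y
  have t_near: "\<bar>t k y - c y\<bar> \<le> 1 / (k + 1)" for k y
  proof -
    have "t k y - c y = (of_int \<lfloor>real (k + 1) * c y\<rfloor> - real (k + 1) * c y) / real (k + 1)"
      by (simp add: t_def field_simps)
    moreover have "\<bar>of_int \<lfloor>real (k + 1) * c y\<rfloor> - real (k + 1) * c y\<bar> \<le> 1"
      by linarith
    then have "\<bar>of_int \<lfloor>real (k + 1) * c y\<rfloor> - real (k + 1) * c y\<bar> / real (k + 1) \<le> 1 / real (k + 1)"
      by (rule divide_right_mono) simp
    ultimately show ?thesis by (simp add: abs_divide add.commute)
  qed
  have step: "borel_step \<Omega> (t k)" for k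
    unfolding borel_step_def
  proof (rule simple_function_borel_measurable)
    have "t k \<in> borel_measurable borel"
      unfolding t_def c_def using g' by measurable
    then show "t k \<in> borel_measurable (restrict_space borel \<Omega>)"
      by (rule measurable_restrict_space1)
    have "t k y \<in> (\<lambda>i. of_int i / real (k + 1)) ` {\<lfloor>- (real (k + 1) * \<bar>C\<bar>)\<rfloor>..\<lfloor>real (k + 1) * \<bar>C\<bar>\<rfloor>}" for y
    proof -
      have "real (k + 1) * \<bar>c y\<bar> \<le> real (k + 1) * \<bar>C\<bar>"
        by (intro mult_left_mono c_bd) auto
      moreover have "real (k + 1) * \<bar>c y\<bar> = \<bar>real (k + 1) * c y\<bar>"
        by (simp add: abs_mult)
      ultimately have "- (real (k + 1) * \<bar>C\<bar>) \<le> real (k + 1) * c y" "real (k + 1) * c y \<le> real (k + 1) * \<bar>C\<bar>"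
        by linarith+
      then show ?thesis
        unfolding t_def by (intro imageI) (simp only: atLeastAtMost_iff, intro conjI floor_mono)
    qed
    then have "t k ` space (restrict_space borel \<Omega>) \<subseteq>
        (\<lambda>i. of_int i / real (k + 1)) ` {\<lfloor>- (real (k + 1) * \<bar>C\<bar>)\<rfloor>..\<lfloor>real (k + 1) * \<bar>C\<bar>\<rfloor>}"
      by blast
    then show "finite (t k ` space (restrict_space borel \<Omega>))"
      by (rule finite_subset) auto
  qed
  have t_bd: "\<bar>t k y\<bar> \<le> \<bar>C\<bar> + 1" for k y
  proof -
    have "1 / (real k + 1) \<le> 1" by simp
    then show ?thesis using t_near[of k y] c_bd[of y] by linarith
  qed
  have "step_integral \<Omega> \<mu> (t k) \<in> {(- (\<bar>C\<bar> + 1)) * \<mu> \<Omega>..(\<bar>C\<bar> + 1) * \<mu> \<Omega>}" for k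
  proof -
    have "step_integral \<Omega> \<mu> (\<lambda>y. - (\<bar>C\<bar> + 1)) \<le> step_integral \<Omega> \<mu> (t k)"
    proof (intro step_integral_mono step step_const)
      show "- (\<bar>C\<bar> + 1) \<le> t k y" for y using t_bd[of k y] by linarith
    qed
    moreover have "step_integral \<Omega> \<mu> (t k) \<le> step_integral \<Omega> \<mu> (\<lambda>y. \<bar>C\<bar> + 1)"
      using t_bd[of k, THEN abs_le_D1] by (intro step_integral_mono step step_const)
    ultimately show ?thesis by (simp add: step_integral_const)
  qed
  then obtain I r where r: "strict_mono r" and I: "((\<lambda>k. step_integral \<Omega> \<mu> (t k)) \<circ> r) \<longlonglongrightarrow> I"
    using compact_imp_seq_compact[OF compact_Icc, unfolded seq_compact_def] by meson
  have I: "(\<lambda>k. step_integral \<Omega> \<mu> (t (r k))) \<longlonglongrightarrow> I"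
    using I by (simp add: o_def)
  \<comment> \<open>Since \<open>r k \<ge> k\<close>, the subsequence keeps the rate
    \<open>1 / (k + 1)\<close>.\<close>
  have r_near: "\<bar>t (r k) y - c y\<bar> \<le> 1 / (k + 1)" for k y
  proof -
    have "1 / (real (r k) + 1) \<le> 1 / (real k + 1)"
      using seq_suble[OF r, of k] by (intro divide_left_mono) auto
    then show ?thesis using t_near[of "r k" y] by linarith
  qed
  have lim: "(\<lambda>k. 1 / (real k + 1)) \<longlonglongrightarrow> 0"
    using LIMSEQ_inverse_real_of_nat by (simp add: inverse_eq_divide add.commute)
  show ?thesis
    unfolding fa_has_integral_def
  proof (intro exI[of _ I] exI[of _ "\<lambda>k. t (r k)"] conjI allI impI step I)
    fix \<epsilon> :: real assume "\<epsilon> > 0"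
    have "\<forall>\<^sub>F k in sequentially. outer \<Omega> \<mu> {y \<in> \<Omega>. \<bar>t (r k) y - g y\<bar> > \<epsilon>} = 0"
      using order_tendstoD(2)[OF lim \<open>\<epsilon> > 0\<close>]
    proof eventually_elim
      case (elim k)
      have "{y \<in> \<Omega>. \<bar>t (r k) y - g y\<bar> > \<epsilon>} \<subseteq> Z"
      proof safe
        fix y assume y: "y \<in> \<Omega>" "\<bar>t (r k) y - g y\<bar> > \<epsilon>"
        show "y \<in> Z"
          using r_near[of k y] elim y c_eq[of y] by (cases "y \<in> Z") auto
      qed
      then show ?case by (rule outer_eq_0[OF Z(1) _ Z(2)])
    qed
    then show "(\<lambda>k. outer \<Omega> \<mu> {y \<in> \<Omega>. \<bar>t (r k) y - g y\<bar> > \<epsilon>}) \<longlonglongrightarrow> 0"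
      by (rule tendsto_eventually)
  next
    have diff: "borel_step \<Omega> (\<lambda>y. \<bar>t (r k) y - t (r l) y\<bar>)" for k l
      using step[unfolded borel_step_def] step[unfolded borel_step_def]
      unfolding borel_step_def by (rule simple_function_compose2)
    have "((\<lambda>kl. (1 / (real (fst kl) + 1) + 1 / (real (snd kl) + 1)) * \<mu> \<Omega>) \<longlongrightarrow> (0 + 0) * \<mu> \<Omega>)
        (sequentially \<times>\<^sub>F sequentially)"
      by (intro tendsto_intros filterlim_compose[OF lim] filterlim_fst filterlim_snd)
    then have bound: "((\<lambda>kl. (1 / (real (fst kl) + 1) + 1 / (real (snd kl) + 1)) * \<mu> \<Omega>) \<longlongrightarrow> 0)
        (sequentially \<times>\<^sub>F sequentially)" by simp
    show "((\<lambda>(k, l). step_integral \<Omega> \<mu> (\<lambda>y. \<bar>t (r k) y - t (r l) y\<bar>)) \<longlongrightarrow> 0)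
        (sequentially \<times>\<^sub>F sequentially)"
      unfolding case_prod_unfold
    proof (rule tendsto_sandwich[OF _ _ tendsto_const bound]; rule always_eventually; rule allI)
      fix kl :: "nat \<times> nat"
      show "0 \<le> step_integral \<Omega> \<mu> (\<lambda>y. \<bar>t (r (fst kl)) y - t (r (snd kl)) y\<bar>)"
        using step_integral_mono[OF step_const[of 0] diff] by (simp add: step_integral_const)
      have "\<bar>t (r (fst kl)) y - t (r (snd kl)) y\<bar> \<le> 1 / (real (fst kl) + 1) + 1 / (real (snd kl) + 1)" for y
        using r_near[of "fst kl" y] r_near[of "snd kl" y] by (simp add: add.commute)
      then show "step_integral \<Omega> \<mu> (\<lambda>y. \<bar>t (r (fst kl)) y - t (r (snd kl)) y\<bar>) \<le>
          (1 / (real (fst kl) + 1) + 1 / (real (snd kl) + 1)) * \<mu> \<Omega>"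
        unfolding step_integral_const[symmetric] by (intro step_integral_mono diff step_const)
    qed
  qed
qed

text \<open>The approximating step functions may be very negative on sets of small \<open>\<mu>\<close>-measure; there they are
  compared with one fixed step function of the sequence.\<close>

lemma fa_has_integral_pos:
  assumes int: "fa_has_integral \<Omega> \<mu> g I" and "\<epsilon> > 0" and pos: "\<mu> \<Omega> > 0"
    and E: "E \<in> borel_subsets \<Omega>" "\<mu> (\<Omega> - E) = 0" "\<And>y. y \<in> E \<Longrightarrow> g y \<ge> \<epsilon>"
  shows "I > 0"
proof -
  obtain h where step: "\<And>k. borel_step \<Omega> (h k)"
    and out: "(\<lambda>k. outer \<Omega> \<mu> {y \<in> \<Omega>. \<bar>h k y - g y\<bar> > \<epsilon> / 2}) \<longlonglongrightarrow> 0"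
    and cauchy: "((\<lambda>(k, l). step_integral \<Omega> \<mu> (\<lambda>y. \<bar>h k y - h l y\<bar>)) \<longlongrightarrow> 0)
           (sequentially \<times>\<^sub>F sequentially)"
    and lim: "(\<lambda>k. step_integral \<Omega> \<mu> (h k)) \<longlonglongrightarrow> I"
    using int \<open>\<epsilon> > 0\<close> unfolding fa_has_integral_def by (meson half_gt_zero)
  \<comment> \<open>With the factor 8, \<open>\<epsilon> / 2 * \<mu> \<Omega>\<close> is four times
    \<open>\<eta>\<close>. The exceptional set \<open>Z\<close> below costs less than one
    \<open>\<eta>\<close> and the mean distance to \<open>h n\<close> another, so more than
    \<open>\<eta>\<close> remains.\<close>
  define \<eta> where "\<eta> = \<epsilon> * \<mu> \<Omega> / 8"
  have "\<eta> > 0" using \<open>\<epsilon> > 0\<close> pos by (simp add: \<eta>_def)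
  obtain n where n: "\<And>k l. k \<ge> n \<Longrightarrow> l \<ge> n \<Longrightarrow> step_integral \<Omega> \<mu> (\<lambda>y. \<bar>h k y - h l y\<bar>) < \<eta>"
    using order_tendstoD(2)[OF cauchy \<open>\<eta> > 0\<close>]
    unfolding eventually_prod_sequentially by auto
  \<comment> \<open>\<open>h n\<close> is the fixed function for the comparison; its bound
    \<open>M\<close> does not depend on \<open>k\<close>, so the tolerated measure of the
    exceptional set can be chosen before \<open>k\<close>.\<close>
  obtain M where M: "M > 0" "\<And>y. y \<in> \<Omega> \<Longrightarrow> \<bar>h n y\<bar> \<le> M"
    using finite_imp_bounded[OF step_range[OF step[of n, unfolded borel_step_def]]]
    by (auto simp: bounded_pos)
  have "\<forall>\<^sub>F k in sequentially. \<eta> \<le> step_integral \<Omega> \<mu> (h k)"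
  proof -
    \<comment> \<open>On \<open>Z\<close> the lower bound drops from \<open>\<epsilon> / 2\<close>
      to \<open>- M\<close>, which costs \<open>\<epsilon> / 2 + M\<close> per unit of
      measure.\<close>
    have "0 < \<eta> / (\<epsilon> / 2 + M)" using \<open>\<eta> > 0\<close> \<open>\<epsilon> > 0\<close> M(1) by simp
    from order_tendstoD(2)[OF out this] eventually_ge_at_top[of n] show ?thesis
    proof eventually_elim
      case (elim k)
      obtain B where B: "B \<in> borel_subsets \<Omega>" "{y \<in> \<Omega>. \<bar>h k y - g y\<bar> > \<epsilon> / 2} \<subseteq> B"
        "\<mu> B < \<eta> / (\<epsilon> / 2 + M)"
        using outer_less[OF elim(1)] by auto
      define Z where "Z = B \<union> (\<Omega> - E)"
      have Z: "Z \<in> borel_subsets \<Omega>" unfolding Z_def by (intro Un_in Diff_in B E space_in)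
      have "\<mu> Z \<le> \<mu> B"
        using subadditive[OF B(1) Diff_in[OF space_in E(1)]] E(2) by (simp add: Z_def)
      then have "(\<epsilon> / 2 + M) * \<mu> Z < \<eta>"
        using B(3) \<open>\<epsilon> > 0\<close> M(1) by (simp add: field_simps) (smt (verit) mult_left_mono)
      moreover have diff: "borel_step \<Omega> (\<lambda>y. \<bar>h k y - h n y\<bar>)"
        using step[unfolded borel_step_def] step[unfolded borel_step_def]
        unfolding borel_step_def by (rule simple_function_compose2)
      have sum: "borel_step \<Omega> (\<lambda>y. h k y + \<bar>h k y - h n y\<bar>)"
        using step diff unfolding borel_step_def by (rule simple_function_compose2)
      \<comment> \<open>Always \<open>h k y + \<bar>h k y - h n y\<bar> \<ge> h n y\<close>, which
        is at least \<open>- M\<close>. Off \<open>Z\<close>, \<open>h k\<close> is within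
        \<open>\<epsilon> / 2\<close> of \<open>g\<close>, and \<open>g\<close> is at least
        \<open>\<epsilon>\<close> there.\<close>
      have "(if y \<in> Z then - M else \<epsilon> / 2) \<le> h k y + \<bar>h k y - h n y\<bar>" if "y \<in> \<Omega>" for y
      proof (cases "y \<in> Z")
        case True
        then show ?thesis using M(2)[OF that] by simp
      next
        case False
        then have "y \<in> E" "\<not> \<bar>h k y - g y\<bar> > \<epsilon> / 2" using B(2) that by (auto simp: Z_def)
        with E(3)[of y] have "\<epsilon> / 2 \<le> h k y" by linarith
        with False show ?thesis by (simp add: add_increasing2)
      qed
      then have "step_integral \<Omega> \<mu> (\<lambda>y. if y \<in> Z then - M else \<epsilon> / 2) \<le>
          step_integral \<Omega> \<mu> (\<lambda>y. h k y + \<bar>h k y - h n y\<bar>)"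
        by (intro step_integral_mono step_If Z sum)
      then have "- M * \<mu> Z + \<epsilon> / 2 * (\<mu> \<Omega> - \<mu> Z) \<le> step_integral \<Omega> \<mu> (h k) + \<eta>"
        using n[OF elim(2) order_refl] step_integral_add[OF step diff]
        by (simp add: step_integral_If[OF Z] compl[OF Z])
      ultimately show ?case using \<open>\<eta> > 0\<close> by (simp add: \<eta>_def algebra_simps)
    qed
  qed
  then have "\<eta> \<le> I" by (intro tendsto_lowerbound[OF lim]) auto
  with \<open>\<eta> > 0\<close> show ?thesis by simp
qed

end

section \<open>Existence of densities\<close>

text \<open>The filter \<open>G\<close> plays the role of an ultrafilter; it comes from Tychonoff's theorem.\<close>

lemma convergent_subfilter:
  fixes q :: "'b \<Rightarrow> 'c \<Rightarrow> real"
  assumes "F \<noteq> bot" "\<And>t A. q t A \<in> {a..b}"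
  obtains G l where "G \<le> F" "G \<noteq> bot" "\<And>A. ((\<lambda>t. q t A) \<longlongrightarrow> l A) G"
proof -
  \<comment> \<open>The topology on functions is that of pointwise convergence, so a cluster point
    in this cube gives limits for all arguments together.\<close>
  have "compactin (product_topology (\<lambda>_. euclidean) UNIV) (PiE UNIV (\<lambda>_::'c. {a..b}))"
    by (simp add: compactin_PiE)
  then have "compact (PiE UNIV (\<lambda>_::'c. {a..b}))"
    by (simp add: euclidean_product_topology)
  moreover have "filtermap q F \<noteq> bot"
    using assms(1) by (simp add: filtermap_bot_iff)
  moreover have "\<forall>\<^sub>F \<nu> in filtermap q F. \<nu> \<in> PiE UNIV (\<lambda>_. {a..b})"
    using assms(2) by (intro eventually_filtermap[THEN iffD2] always_eventually) (auto simp: PiE_UNIV_domain)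
  ultimately obtain l where l: "inf (nhds l) (filtermap q F) \<noteq> bot"
    unfolding compact_filter by blast
  \<comment> \<open>This is the largest filter below \<open>F\<close> along which \<open>q\<close>
    tends to \<open>l\<close>. That \<open>l\<close> is a cluster point is exactly what keeps it
    proper.\<close>
  define G where "G = inf F (filtercomap q (nhds l))"
  have "G \<noteq> bot"
  proof
    assume "G = bot"
    then have "eventually (\<lambda>_. False) G" by simp
    then obtain P Q where PQ: "eventually P F" "eventually Q (nhds l)"
      "\<And>t. P t \<Longrightarrow> Q (q t) \<Longrightarrow> False"
      unfolding G_def eventually_inf eventually_filtercomap by blast
    have "eventually (\<lambda>\<nu>. \<exists>t. P t \<and> \<nu> = q t) (filtermap q F)"
      using PQ(1) unfolding eventually_filtermap by (rule eventually_mono) auto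
    then have "eventually (\<lambda>_. False) (inf (nhds l) (filtermap q F))"
      unfolding eventually_inf using PQ(2,3) by blast
    then show False using l by (simp add: trivial_limit_def)
  qed
  moreover have "((\<lambda>t. q t A) \<longlongrightarrow> l A) G" for A
  proof (rule topological_tendstoI)
    have q: "filterlim q (nhds l) G"
      unfolding G_def by (rule filterlim_mono[OF filterlim_filtercomap order_refl]) simp
    fix S :: "real set" assume S: "open S" "l A \<in> S"
    have "open ((\<lambda>\<nu>. \<nu> A) -` S)"
      using S(1) by (rule open_vimage) simp
    then have "\<forall>\<^sub>F \<nu> in nhds l. \<nu> A \<in> S"
      using eventually_nhds_in_open[of "(\<lambda>\<nu>. \<nu> A) -` S" l] S(2) by simp
    then show "\<forall>\<^sub>F t in G. q t A \<in> S"
      using q by (rule eventually_compose_filterlim)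
  qed
  ultimately show ?thesis
    by (intro that[of G l]) (auto simp: G_def)
qed

text \<open>The density is a limit of the proportions along a proper filter below
  \<open>at_right 0\<close>. Finite additivity, the bound 1 and vanishing on null sets hold for each
  radius and survive the limit, which lies between the lower and the upper limit at 0.\<close>

lemma Leb_Dens_nonempty:
  fixes E :: "'a::euclidean_space set"
  assumes "\<Omega> \<in> sets borel" and E: "E \<in> borel_subsets \<Omega>"
  shows "Leb_Dens \<Omega> E x \<noteq> {}"
proof -
  \<comment> \<open>The product of intervals is indexed by all sets; the value 0 for sets that are
    not Borel keeps \<open>q\<close> in the unit interval where monotonicity of the measure would
    require measurability.\<close>
  define q where "q \<delta> A = (if A \<in> sets borel then
    measure lebesgue (A \<inter> E \<inter> ball x \<delta>) / measure lebesgue (E \<inter> ball x \<delta>) else 0)" for \<delta> A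
  have Eb: "E \<in> sets borel" using E by (simp add: borel_subsets_def)
  have fm: "A \<inter> E \<inter> ball x \<delta> \<in> lmeasurable" if "A \<in> sets borel" for A \<delta>
    using that Eb by (intro bounded_set_imp_lmeasurable) (auto intro: bounded_Int)
  have fm': "E \<inter> ball x \<delta> \<in> lmeasurable" for \<delta>
    using fm[of UNIV] by simp
  \<comment> \<open>For \<open>b = 0\<close> the quotient is 0 by convention and still lies in the
    interval.\<close>
  have quotient_in: "a / b \<in> {0..1}" if "0 \<le> a" "a \<le> b" for a b :: real
    using that by (auto simp: divide_le_eq_1)
  have q01: "q \<delta> A \<in> {0..1}" for \<delta> A
  proof (cases "A \<in> sets borel")
    case True
    have "measure lebesgue (A \<inter> E \<inter> ball x \<delta>) \<le> measure lebesgue (E \<inter> ball x \<delta>)"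
      by (intro measure_mono_fmeasurable fm') (use fm[OF True] in auto)
    moreover have "0 \<le> measure lebesgue (A \<inter> E \<inter> ball x \<delta>)" by simp
    ultimately have "measure lebesgue (A \<inter> E \<inter> ball x \<delta>) / measure lebesgue (E \<inter> ball x \<delta>) \<in> {0..1}"
      using quotient_in by blast
    then show ?thesis
      using True by (simp only: q_def if_True)
  qed (auto simp: q_def)
  obtain G \<mu> where G: "G \<le> at_right 0" "G \<noteq> bot" and lim: "\<And>A. ((\<lambda>\<delta>. q \<delta> A) \<longlongrightarrow> \<mu> A) G"
    using convergent_subfilter[of "at_right 0" q 0 1] q01 by auto
  have "\<mu> \<in> ba \<Omega>"
    unfolding ba_def
  proof (safe intro!: exI[of _ 1])
    fix A
    have "0 \<le> \<mu> A" by (rule tendsto_lowerbound[OF lim]) (use q01 G in auto)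
    moreover have "\<mu> A \<le> 1" by (rule tendsto_upperbound[OF lim]) (use q01 G in auto)
    ultimately show "\<bar>\<mu> A\<bar> \<le> 1" by simp
  next
    show "Measure_Space.additive (borel_subsets \<Omega>) \<mu>"
      unfolding Measure_Space.additive_def
    proof (intro ballI impI)
      fix A B assume AB: "A \<in> borel_subsets \<Omega>" "B \<in> borel_subsets \<Omega>" "A \<inter> B = {}"
      have "q \<delta> (A \<union> B) = q \<delta> A + q \<delta> B" for \<delta>
      proof -
        have "measure lebesgue ((A \<inter> E \<inter> ball x \<delta>) \<union> (B \<inter> E \<inter> ball x \<delta>)) =
            measure lebesgue (A \<inter> E \<inter> ball x \<delta>) + measure lebesgue (B \<inter> E \<inter> ball x \<delta>)"
          using AB by (intro measure_Union fmeasurableD[OF fm] fmeasurableD2[OF fm, folded infinity_ennreal_def])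
              (auto simp: borel_subsets_def)
        moreover have "(A \<inter> E \<inter> ball x \<delta>) \<union> (B \<inter> E \<inter> ball x \<delta>) = (A \<union> B) \<inter> E \<inter> ball x \<delta>"
          by auto
        moreover have "A \<union> B \<in> sets borel" using AB by (auto simp: borel_subsets_def)
        ultimately show ?thesis
          using AB by (simp add: q_def borel_subsets_def add_divide_distrib)
      qed
      then show "\<mu> (A \<union> B) = \<mu> A + \<mu> B"
        using tendsto_unique[OF G(2) lim[of "A \<union> B"]] tendsto_add[OF lim[of A] lim[of B]] by simp
    qed
  next
    fix A assume A: "A \<in> borel_subsets \<Omega>" "emeasure lebesgue A = 0"
    have "measure lebesgue (A \<inter> E \<inter> ball x \<delta>) = 0" for \<delta>
    proof -
      have "emeasure lebesgue (A \<inter> E \<inter> ball x \<delta>) \<le> emeasure lebesgue A"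
        using A by (intro emeasure_mono) (auto simp: borel_subsets_def)
      then show ?thesis using A(2) by (simp add: measure_def)
    qed
    then have "q \<delta> A = 0" for \<delta> by (simp add: q_def)
    then show "\<mu> A = 0"
      using tendsto_unique[OF G(2) lim[of A], of 0] by simp
  qed
  moreover have "Liminf (at_right 0) (\<lambda>\<delta>. ereal (q \<delta> A)) \<le> ereal (\<mu> A)"
    and "ereal (\<mu> A) \<le> Limsup (at_right 0) (\<lambda>\<delta>. ereal (q \<delta> A))" for A
  proof -
    have l: "((\<lambda>\<delta>. ereal (q \<delta> A)) \<longlongrightarrow> ereal (\<mu> A)) G" using lim by simp
    \<comment> \<open>More predicates hold eventually along the finer filter, so the supremum
      defining the lower limit runs over a larger family; dually for the upper limit.\<close>
    have "Liminf (at_right 0) (\<lambda>\<delta>. ereal (q \<delta> A)) \<le> Liminf G (\<lambda>\<delta>. ereal (q \<delta> A))"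
      unfolding Liminf_def by (rule SUP_subset_mono) (use G(1) in \<open>auto simp: le_filter_def\<close>)
    also have "\<dots> = ereal (\<mu> A)" by (rule lim_imp_Liminf[OF G(2) l])
    finally show "Liminf (at_right 0) (\<lambda>\<delta>. ereal (q \<delta> A)) \<le> ereal (\<mu> A)" .
    have "ereal (\<mu> A) = Limsup G (\<lambda>\<delta>. ereal (q \<delta> A))" by (rule lim_imp_Limsup[OF G(2) l, symmetric])
    also have "\<dots> \<le> Limsup (at_right 0) (\<lambda>\<delta>. ereal (q \<delta> A))"
      unfolding Limsup_def by (rule INF_superset_mono) (use G(1) in \<open>auto simp: le_filter_def\<close>)
    finally show "ereal (\<mu> A) \<le> Limsup (at_right 0) (\<lambda>\<delta>. ereal (q \<delta> A))" .
  qed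
  moreover have "measure lebesgue (A \<inter> E \<inter> ball x \<delta>) / measure lebesgue (E \<inter> ball x \<delta>) = q \<delta> A"
    if "A \<in> borel_subsets \<Omega>" for \<delta> A
    using that by (simp add: q_def borel_subsets_def)
  ultimately have "\<mu> \<in> Leb_Dens \<Omega> E x"
    by (simp add: Leb_Dens_def)
  then show ?thesis by auto
qed

section \<open>Mass and localization of Lebesgue densities\<close>

lemma Leb_Dens_eqI:
  assumes \<mu>: "\<mu> \<in> Leb_Dens \<Omega> E x" and "A \<in> borel_subsets \<Omega>"
    and "\<forall>\<^sub>F \<delta> in at_right 0. measure lebesgue (A \<inter> E \<inter> ball x \<delta>) / measure lebesgue (E \<inter> ball x \<delta>) = c"
  shows "\<mu> A = c"
proof -
  let ?q = "\<lambda>\<delta>. ereal (measure lebesgue (A \<inter> E \<inter> ball x \<delta>) / measure lebesgue (E \<inter> ball x \<delta>))"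
  have "(?q \<longlongrightarrow> ereal c) (at_right 0)"
    using assms(3) by (intro tendsto_eventually) (auto elim: eventually_mono)
  then have "Liminf (at_right 0) ?q = ereal c" "Limsup (at_right 0) ?q = ereal c"
    by (auto intro: lim_imp_Liminf lim_imp_Limsup)
  moreover have "Liminf (at_right 0) ?q \<le> ereal (\<mu> A)" "ereal (\<mu> A) \<le> Limsup (at_right 0) ?q"
    using \<mu> assms(2) by (simp_all only: Leb_Dens_def mem_Collect_eq)
  ultimately show ?thesis by simp
qed

text \<open>A Borel subset of \<open>\<Omega>\<close> that contains \<open>E\<close> near
  \<open>x\<close> has proportion exactly 1 for all small radii, so its mass is forced;
  \<open>E\<close>, \<open>\<Omega>\<close> and the balls are such sets. Nonnegativity comes from
  the lower limit, since proportions are nonnegative.\<close>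

lemma
  fixes E :: "'a::euclidean_space set"
  assumes \<Omega>: "\<Omega> \<in> sets borel" and E: "E \<in> borel_subsets \<Omega>"
    and pos: "\<And>\<delta>. \<delta> > 0 \<Longrightarrow> emeasure lebesgue (ball x \<delta> \<inter> E) > 0"
    and \<mu>: "\<mu> \<in> Leb_Dens \<Omega> E x"
  shows Leb_Dens_self: "\<mu> E = 1" and Leb_Dens_subset_Dens: "\<mu> \<in> Dens \<Omega> x"
proof -
  have Eb: "E \<in> sets borel" "E \<subseteq> \<Omega>" using E by (auto simp: borel_subsets_def)
  have ball_pos: "measure lebesgue (E \<inter> ball x \<delta>) > 0" if "\<delta> > 0" for \<delta>
  proof -
    have "E \<inter> ball x \<delta> \<in> lmeasurable"
      using Eb by (intro bounded_set_imp_lmeasurable) (auto intro: bounded_Int)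
    from emeasure_eq_measure2[OF this] have "0 < ennreal (measure lebesgue (E \<inter> ball x \<delta>))"
      using pos[OF that] by (simp only: Int_commute)
    then show ?thesis by (simp only: ennreal_less_zero_iff)
  qed
  have one: "\<mu> A = 1" if A: "A \<in> borel_subsets \<Omega>" "E \<inter> ball x d \<subseteq> A" "d > 0" for A d
  proof (rule Leb_Dens_eqI[OF \<mu> A(1)])
    have "\<forall>\<^sub>F \<delta> in at_right 0. \<delta> < d" using A(3) by (rule eventually_at_right_real[THEN eventually_mono]) auto
    moreover have "\<forall>\<^sub>F \<delta> in at_right (0::real). \<delta> > 0" by (rule eventually_at_right_less)
    ultimately show "\<forall>\<^sub>F \<delta> in at_right 0.
        measure lebesgue (A \<inter> E \<inter> ball x \<delta>) / measure lebesgue (E \<inter> ball x \<delta>) = 1"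
    proof eventually_elim
      case (elim \<delta>)
      then have "A \<inter> E \<inter> ball x \<delta> = E \<inter> ball x \<delta>" using A(2) by auto
      then show ?case using ball_pos[OF elim(2)] by simp
    qed
  qed
  show "\<mu> E = 1" by (rule one[OF E, of 1]) auto
  have nonneg: "0 \<le> \<mu> A" if "A \<in> borel_subsets \<Omega>" for A
  proof -
    have "0 \<le> Liminf (at_right 0) (\<lambda>\<delta>. ereal (measure lebesgue (A \<inter> E \<inter> ball x \<delta>) / measure lebesgue (E \<inter> ball x \<delta>)))"
      by (intro Liminf_bounded always_eventually) simp
    also have "\<dots> \<le> ereal (\<mu> A)" using \<mu> that by (auto simp: Leb_Dens_def)
    finally show ?thesis by simp
  qed
  have "\<mu> (ball x \<delta> \<inter> \<Omega>) = 1" if "\<delta> > 0" for \<delta>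
    using \<Omega> Eb that by (intro one[of _ \<delta>]) (auto simp: borel_subsets_def)
  moreover have "\<mu> \<Omega> = 1"
    using \<Omega> Eb by (intro one[of _ 1]) (auto simp: borel_subsets_def)
  ultimately show "\<mu> \<in> Dens \<Omega> x"
    using \<mu> nonneg by (auto simp: Dens_def Leb_Dens_def)
qed

lemma Dens_nonneg_ba: "\<Omega> \<in> sets borel \<Longrightarrow> \<mu> \<in> Dens \<Omega> x \<Longrightarrow> nonneg_ba \<Omega> \<mu>"
  by unfold_locales (auto simp: Dens_def)

lemma Dens_compl_ball:
  assumes "\<Omega> \<in> sets borel" "\<mu> \<in> Dens \<Omega> x" "\<delta> > 0"
  shows "\<mu> (\<Omega> - ball x \<delta>) = 0"
proof -
  interpret nonneg_ba \<Omega> \<mu> by (rule Dens_nonneg_ba[OF assms(1,2)])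
  have "\<mu> (\<Omega> - (ball x \<delta> \<inter> \<Omega>)) = 0"
    using assms by (subst compl) (auto simp: borel_subsets_def Dens_def)
  moreover have "\<Omega> - (ball x \<delta> \<inter> \<Omega>) = \<Omega> - ball x \<delta>" by auto
  ultimately show ?thesis by simp
qed

section \<open>Essential limits\<close>

lemma borel_measurable_lebesgue_on_subset:
  "g \<in> borel_measurable (lebesgue_on \<Omega>) \<Longrightarrow> S \<subseteq> \<Omega> \<Longrightarrow> g \<in> borel_measurable (lebesgue_on S)"
  by (rule measurable_restrict_mono)

lemma AE_lebesgue_on_iff:
  "S \<in> sets borel \<Longrightarrow> (AE y in lebesgue_on S. P y) \<longleftrightarrow> (AE y in lebesgue. y \<in> S \<longrightarrow> P y)"
  by (rule AE_restrict_space_iff) auto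

text \<open>On a null set the essential supremum is minus infinity in \<open>ereal\<close>, even for
  a norm. Positive measure excludes this, which is how \<open>x \<in> hat \<Omega>\<close> enters
  \<open>has_ess_lim_iff\<close>.\<close>

lemma esssup_norm_nonneg:
  assumes "g \<in> borel_measurable (lebesgue_on S)" "S \<in> sets borel" "emeasure lebesgue S > 0"
  shows "0 \<le> esssup (lebesgue_on S) (\<lambda>y. ereal (norm (g y)))"
proof -
  have "(0::ereal) = esssup (lebesgue_on S) (\<lambda>y. 0)"
    using assms by (subst esssup_const) (auto simp: emeasure_restrict_space space_restrict_space)
  also have "\<dots> \<le> esssup (lebesgue_on S) (\<lambda>y. ereal (norm (g y)))"
    by (intro esssup_AE_mono) auto
  finally show ?thesis .
qed

text \<open>Almost everywhere bounds restrict to smaller balls, so convergence of the essential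
  suprema reduces to one radius for each \<open>\<epsilon>\<close>; this form also feeds directly
  into \<open>AE_cover\<close>.\<close>

lemma has_ess_lim_iff:
  assumes \<Omega>: "\<Omega> \<in> sets borel" and x: "x \<in> hat \<Omega>" and g: "g \<in> borel_measurable (lebesgue_on \<Omega>)"
  shows "has_ess_lim \<Omega> g x \<beta> \<longleftrightarrow>
    (\<forall>\<epsilon>>0. \<exists>\<delta>>0. AE y in lebesgue. y \<in> ball x \<delta> \<inter> \<Omega> \<longrightarrow> norm (g y - \<beta>) \<le> \<epsilon>)"
    (is "_ \<longleftrightarrow> (\<forall>\<epsilon>>0. \<exists>\<delta>>0. ?P \<epsilon> \<delta>)")
proof -
  let ?s = "\<lambda>\<delta>. esssup (lebesgue_on (ball x \<delta> \<inter> \<Omega>)) (\<lambda>y. ereal (norm (g y - \<beta>)))"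
  have S: "ball x \<delta> \<inter> \<Omega> \<in> sets borel" for \<delta> using \<Omega> by auto
  have meas: "(\<lambda>y. g y - \<beta>) \<in> borel_measurable (lebesgue_on (ball x \<delta> \<inter> \<Omega>))" for \<delta>
    using borel_measurable_lebesgue_on_subset[OF g, of "ball x \<delta> \<inter> \<Omega>"] by measurable
  have meas': "(\<lambda>y. ereal (norm (g y - \<beta>))) \<in> borel_measurable (lebesgue_on (ball x \<delta> \<inter> \<Omega>))" for \<delta>
    using meas[of \<delta>] by measurable
  have nonneg: "0 \<le> ?s \<delta>" if "\<delta> > 0" for \<delta>
    using x that by (intro esssup_norm_nonneg[OF meas S]) (auto simp: hat_def Int_commute)
  show ?thesis
  proof
    assume L: "has_ess_lim \<Omega> g x \<beta>"
    show "\<forall>\<epsilon>>0. \<exists>\<delta>>0. ?P \<epsilon> \<delta>"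
    proof (intro allI impI)
      fix \<epsilon> :: real assume "\<epsilon> > 0"
      have "\<forall>\<^sub>F \<delta> in at_right 0. ?s \<delta> < ereal \<epsilon>"
        using L \<open>\<epsilon> > 0\<close> unfolding has_ess_lim_def by (intro order_tendstoD(2)) auto
      then have "\<exists>b>0. \<forall>\<delta>>0. \<delta> < b \<longrightarrow> ?s \<delta> < ereal \<epsilon>"
        by (simp only: eventually_at_right_field)
      then obtain b where "b > 0" "\<And>\<delta>. \<delta> > 0 \<Longrightarrow> \<delta> < b \<Longrightarrow> ?s \<delta> < ereal \<epsilon>"
        by auto
      then have \<delta>: "b / 2 > 0" "?s (b / 2) < ereal \<epsilon>" by simp_all
      define \<delta> where "\<delta> = b / 2"
      note \<delta> = \<delta>[folded \<delta>_def]
      have "AE y in lebesgue_on (ball x \<delta> \<inter> \<Omega>). ereal (norm (g y - \<beta>)) \<le> ?s \<delta>"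
        by (rule esssup_AE)
      then have "AE y in lebesgue_on (ball x \<delta> \<inter> \<Omega>). norm (g y - \<beta>) \<le> \<epsilon>"
      proof eventually_elim
        case (elim y)
        then have "ereal (norm (g y - \<beta>)) \<le> ereal \<epsilon>" using \<delta>(2) by (meson order_trans less_imp_le)
        then show ?case by simp
      qed
      then have "?P \<epsilon> \<delta>" by (simp only: AE_lebesgue_on_iff[OF S])
      with \<delta>(1) show "\<exists>\<delta>>0. ?P \<epsilon> \<delta>" by (intro exI[of _ \<delta>] conjI)
    qed
  next
    assume R: "\<forall>\<epsilon>>0. \<exists>\<delta>>0. ?P \<epsilon> \<delta>"
    show "has_ess_lim \<Omega> g x \<beta>"
      unfolding has_ess_lim_def
    proof (rule order_tendstoI)
      fix a :: ereal assume "a < 0"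
      show "\<forall>\<^sub>F \<delta> in at_right 0. a < ?s \<delta>"
        using eventually_at_right_less[of "0::real"]
        by (rule eventually_mono) (rule less_le_trans[OF \<open>a < 0\<close> nonneg])
    next
      fix a :: ereal assume "0 < a"
      then obtain \<epsilon> where \<epsilon>: "0 < \<epsilon>" "ereal \<epsilon> < a"
        using ereal_dense2[of 0 a] by auto
      obtain d where d: "d > 0" "?P \<epsilon> d" using R \<epsilon> by blast
      have "\<forall>\<^sub>F \<delta> in at_right 0. \<delta> < d"
        using d(1) by (rule eventually_at_right_real[THEN eventually_mono]) auto
      then show "\<forall>\<^sub>F \<delta> in at_right 0. ?s \<delta> < a"
      proof eventually_elim
        case (elim \<delta>)
        have "?P \<epsilon> \<delta>" using d(2) by eventually_elim (use elim in auto)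
        then have "AE y in lebesgue_on (ball x \<delta> \<inter> \<Omega>). ereal (norm (g y - \<beta>)) \<le> ereal \<epsilon>"
          by (simp only: AE_lebesgue_on_iff[OF S] ereal_less_eq)
        then have "?s \<delta> \<le> ereal \<epsilon>" by (rule esssup_I[OF meas'])
        then show ?case using \<epsilon>(2) by (rule le_less_trans)
      qed
    qed
  qed
qed

section \<open>Consequences of an essential limit\<close>

lemma Dens_integral_ess_lim:
  assumes \<Omega>: "\<Omega> \<in> sets borel" and \<mu>: "\<mu> \<in> Dens \<Omega> x"
    and lim: "\<And>\<epsilon>. \<epsilon> > 0 \<Longrightarrow> \<exists>\<delta>>0. AE y in lebesgue. y \<in> ball x \<delta> \<inter> \<Omega> \<longrightarrow> \<bar>g y - \<beta>\<bar> \<le> \<epsilon>"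
  shows "fa_has_integral \<Omega> \<mu> g \<beta>"
proof -
  interpret nonneg_ba \<Omega> \<mu> by (rule Dens_nonneg_ba[OF \<Omega> \<mu>])
  have "\<mu> \<Omega> = 1" using \<mu> by (auto simp: Dens_def intro: zero_less_one)
  moreover have "outer \<Omega> \<mu> {y \<in> \<Omega>. \<bar>\<beta> - g y\<bar> > \<epsilon>} = 0" if "\<epsilon> > 0" for \<epsilon>
  proof -
    obtain \<delta> where \<delta>: "\<delta> > 0" "AE y in lebesgue. y \<in> ball x \<delta> \<inter> \<Omega> \<longrightarrow> \<bar>g y - \<beta>\<bar> \<le> \<epsilon>"
      using lim[OF \<open>\<epsilon> > 0\<close>] by blast
    obtain N where N: "N \<in> borel_subsets \<Omega>" "\<mu> N = 0"
      "\<And>y. y \<in> \<Omega> - N \<Longrightarrow> y \<in> ball x \<delta> \<inter> \<Omega> \<longrightarrow> \<bar>g y - \<beta>\<bar> \<le> \<epsilon>"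
      using AE_cover \<delta>(2) by blast
    have D: "\<Omega> - ball x \<delta> \<in> borel_subsets \<Omega>" using \<Omega> by (auto simp: borel_subsets_def)
    have Z: "(\<Omega> - ball x \<delta>) \<union> N \<in> borel_subsets \<Omega>" by (rule Un_in[OF D N(1)])
    have "\<mu> ((\<Omega> - ball x \<delta>) \<union> N) = 0"
      using subadditive[OF D N(1)] nonneg[OF Z] N(2) Dens_compl_ball[OF \<Omega> \<mu> \<delta>(1)] by simp
    moreover have "{y \<in> \<Omega>. \<bar>\<beta> - g y\<bar> > \<epsilon>} \<subseteq> (\<Omega> - ball x \<delta>) \<union> N"
      using N(3) by (force simp: abs_minus_commute)
    ultimately show ?thesis by (intro outer_eq_0[OF Z])
  qed
  ultimately show ?thesis
    using fa_has_integral_const[of \<beta> g] by simp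
qed

lemma ess_lim_imp_ap_lim:
  assumes \<Omega>: "\<Omega> \<in> sets borel" and x: "x \<in> hat \<Omega>" and g: "g \<in> borel_measurable (lebesgue_on \<Omega>)"
    and lim: "has_ess_lim \<Omega> g x \<beta>"
  shows "has_ap_lim \<Omega> g x \<beta>"
  unfolding has_ap_lim_def
proof (intro allI impI)
  fix \<epsilon> :: real assume "\<epsilon> > 0"
  \<comment> \<open>Half of \<open>\<epsilon>\<close> makes the bound strict, so the set where the
    distance is at least \<open>\<epsilon>\<close> is null in small balls: the proportion is
    eventually 0, not merely small.\<close>
  then obtain d where d: "d > 0" "AE y in lebesgue. y \<in> ball x d \<inter> \<Omega> \<longrightarrow> norm (g y - \<beta>) \<le> \<epsilon> / 2"
    using lim unfolding has_ess_lim_iff[OF \<Omega> x g] by (meson half_gt_zero)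
  have "\<forall>\<^sub>F \<delta> in at_right 0. \<delta> < d"
    using d(1) by (rule eventually_at_right_real[THEN eventually_mono]) auto
  then have "\<forall>\<^sub>F \<delta> in at_right 0. measure lebesgue (ball x \<delta> \<inter> \<Omega> \<inter> {y. norm (g y - \<beta>) \<ge> \<epsilon>})
      / measure lebesgue (ball x \<delta> \<inter> \<Omega>) = 0"
  proof eventually_elim
    case (elim \<delta>)
    have "AE y in lebesgue. y \<notin> ball x \<delta> \<inter> \<Omega> \<inter> {y. norm (g y - \<beta>) \<ge> \<epsilon>}"
      using d(2) by eventually_elim (use elim \<open>\<epsilon> > 0\<close> in auto)
    then obtain N where N: "N \<in> null_sets lebesgue"
      "{y. \<not> y \<notin> ball x \<delta> \<inter> \<Omega> \<inter> {y. norm (g y - \<beta>) \<ge> \<epsilon>}} \<subseteq> N"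
      by (simp only: eventually_ae_filter space_completion space_lborel space_borel UNIV_I simp_thms Bex_def) blast
    have "ball x \<delta> \<inter> \<Omega> \<inter> {y. norm (g y - \<beta>) \<ge> \<epsilon>} \<in> null_sets lebesgue"
      by (rule null_sets_completion_subset[OF _ N(1)]) (use N(2) in blast)
    then have "measure lebesgue (ball x \<delta> \<inter> \<Omega> \<inter> {y. norm (g y - \<beta>) \<ge> \<epsilon>}) = 0"
      by (simp add: measure_def null_setsD1)
    then show ?case by simp
  qed
  then show "((\<lambda>\<delta>. measure lebesgue (ball x \<delta> \<inter> \<Omega> \<inter> {y. norm (g y - \<beta>) \<ge> \<epsilon>})
      / measure lebesgue (ball x \<delta> \<inter> \<Omega>)) \<longlongrightarrow> 0) (at_right 0)"
    by (rule tendsto_eventually)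
qed

text \<open>The mean of \<open>f\<close> minus \<open>v\<close> is the mean of \<open>f - v\<close>.
  Integrability is derived from the bound because local integrability does not reach a set such as
  \<open>ball x \<delta> \<inter> \<Omega>\<close>, which need not lie in a compact subset of
  \<open>\<Omega>\<close>.\<close>

lemma average_near:
  fixes f :: "'a::euclidean_space \<Rightarrow> 'b::euclidean_space"
  assumes S: "S \<in> lmeasurable" "measure lebesgue S > 0"
    and f: "f \<in> borel_measurable (lebesgue_on S)"
    and bd: "AE y in lebesgue. y \<in> S \<longrightarrow> norm (f y - v) \<le> \<epsilon>"
  shows "set_integrable lebesgue S f"
    and "norm ((1 / measure lebesgue S) *\<^sub>R set_lebesgue_integral lebesgue S f - v) \<le> \<epsilon>"
proof -
  have Sm: "S \<in> sets lebesgue" using S(1) by (rule fmeasurableD)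
  interpret finite_measure "lebesgue_on S"
    by (rule finite_measure_lebesgue_on[OF S(1)])
  have ae: "AE y in lebesgue_on S. norm (f y - v) \<le> \<epsilon>"
    using bd Sm by (subst AE_restrict_space_iff) auto
  have int0: "integrable (lebesgue_on S) (\<lambda>y. f y - v)"
    using ae f by (intro integrable_const_bound[of _ \<epsilon>]) auto
  then have int: "integrable (lebesgue_on S) f"
    using Bochner_Integration.integrable_add[OF int0 integrable_const[of v]] by simp
  show "set_integrable lebesgue S f"
    using int Sm by (simp add: set_integrable_def integrable_restrict_space)
  have m: "measure (lebesgue_on S) S = measure lebesgue S"
    using Sm by (simp add: measure_restrict_space space_restrict_space)
  have "norm (\<integral>y. f y - v \<partial>lebesgue_on S) \<le> (\<integral>y. norm (f y - v) \<partial>lebesgue_on S)"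
    by (rule integral_norm_bound)
  also have "\<dots> \<le> (\<integral>y. \<epsilon> \<partial>lebesgue_on S)"
    using int0 ae by (intro integral_mono_AE) auto
  also have "\<dots> = \<epsilon> * measure lebesgue S"
    by (simp add: m)
  finally have "norm (integral\<^sup>L (lebesgue_on S) f - measure lebesgue S *\<^sub>R v) \<le> \<epsilon> * measure lebesgue S"
    using int by (simp add: m)
  moreover have "set_lebesgue_integral lebesgue S f = integral\<^sup>L (lebesgue_on S) f"
    using Sm by (simp add: set_lebesgue_integral_def integral_restrict_space)
  moreover have "(1 / measure lebesgue S) *\<^sub>R integral\<^sup>L (lebesgue_on S) f - v =
      (1 / measure lebesgue S) *\<^sub>R (integral\<^sup>L (lebesgue_on S) f - measure lebesgue S *\<^sub>R v)"
    using S(2) by (simp add: algebra_simps)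
  ultimately show "norm ((1 / measure lebesgue S) *\<^sub>R set_lebesgue_integral lebesgue S f - v) \<le> \<epsilon>"
    using S(2) by (simp only: norm_scaleR) (simp add: divide_simps mult.commute)
qed

lemma hat_ball_pos: "x \<in> hat \<Omega> \<Longrightarrow> \<delta> > 0 \<Longrightarrow> emeasure lebesgue (ball x \<delta> \<inter> \<Omega>) > 0"
  by (simp only: hat_def mem_Collect_eq Int_commute)

lemma ess_lim_imp_fstar:
  assumes \<Omega>: "\<Omega> \<in> sets borel" and x: "x \<in> hat \<Omega>" and g: "g \<in> borel_measurable (lebesgue_on \<Omega>)"
    and lim: "has_ess_lim \<Omega> g x \<beta>"
  shows "has_fstar \<Omega> g x \<beta>"
proof -
  let ?S = "\<lambda>\<delta>. ball x \<delta> \<inter> \<Omega>"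
  have S: "?S \<delta> \<in> lmeasurable" for \<delta>
    using \<Omega> by (intro bounded_set_imp_lmeasurable) (auto intro: bounded_Int)
  have pos: "measure lebesgue (?S \<delta>) > 0" if "\<delta> > 0" for \<delta>
  proof -
    have "0 < emeasure lebesgue (?S \<delta>)" by (rule hat_ball_pos[OF x that])
    then show ?thesis by (simp only: emeasure_eq_measure2[OF S] ennreal_less_zero_iff)
  qed
  have near: "\<forall>\<^sub>F \<delta> in at_right 0. set_integrable lebesgue (?S \<delta>) g \<and>
      norm ((1 / measure lebesgue (?S \<delta>)) *\<^sub>R set_lebesgue_integral lebesgue (?S \<delta>) g - \<beta>) \<le> \<epsilon>"
    if "\<epsilon> > 0" for \<epsilon>
  proof -
    obtain d where d: "d > 0" "AE y in lebesgue. y \<in> ?S d \<longrightarrow> norm (g y - \<beta>) \<le> \<epsilon>"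
      using lim \<open>\<epsilon> > 0\<close> unfolding has_ess_lim_iff[OF \<Omega> x g] by blast
    have "\<forall>\<^sub>F \<delta> in at_right 0. \<delta> < d"
      using d(1) by (rule eventually_at_right_real[THEN eventually_mono]) auto
    moreover have "\<forall>\<^sub>F \<delta> in at_right (0::real). \<delta> > 0" by (rule eventually_at_right_less)
    ultimately show ?thesis
    proof eventually_elim
      case (elim \<delta>)
      have "AE y in lebesgue. y \<in> ?S \<delta> \<longrightarrow> norm (g y - \<beta>) \<le> \<epsilon>"
        using d(2) by eventually_elim (use elim in auto)
      with average_near[OF S pos[OF elim(2)] borel_measurable_lebesgue_on_subset[OF g]]
      show ?case by blast
    qed
  qed
  show ?thesis
    unfolding has_fstar_def
  proof
    show "\<forall>\<^sub>F \<delta> in at_right 0. set_integrable lebesgue (?S \<delta>) g"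
      using near[of 1] by (auto elim: eventually_mono)
    show "((\<lambda>\<delta>. (1 / measure lebesgue (?S \<delta>)) *\<^sub>R set_lebesgue_integral lebesgue (?S \<delta>) g) \<longlongrightarrow> \<beta>) (at_right 0)"
    proof (rule tendstoI)
      fix e :: real assume "e > 0"
      then show "\<forall>\<^sub>F \<delta> in at_right 0. dist ((1 / measure lebesgue (?S \<delta>)) *\<^sub>R
          set_lebesgue_integral lebesgue (?S \<delta>) g) \<beta> < e"
        using near[of "e / 2"] by (auto simp: dist_norm elim!: eventually_mono)
    qed
  qed
qed

lemma Dens_vec_integral_ess_lim:
  fixes g :: "'a::euclidean_space \<Rightarrow> real^'m"
  assumes \<Omega>: "\<Omega> \<in> sets borel" and x: "x \<in> hat \<Omega>" and g: "g \<in> borel_measurable (lebesgue_on \<Omega>)"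
    and lim: "has_ess_lim \<Omega> g x \<beta>" and \<mu>: "\<mu> \<in> Dens \<Omega> x"
  shows "fa_has_vec_integral \<Omega> \<mu> g \<beta>"
  unfolding fa_has_vec_integral_def
proof (intro allI Dens_integral_ess_lim[OF \<Omega> \<mu>])
  fix i and \<epsilon> :: real assume "\<epsilon> > 0"
  then obtain d where d: "d > 0" "AE y in lebesgue. y \<in> ball x d \<inter> \<Omega> \<longrightarrow> norm (g y - \<beta>) \<le> \<epsilon>"
    using lim unfolding has_ess_lim_iff[OF \<Omega> x g] by blast
  have "AE y in lebesgue. y \<in> ball x d \<inter> \<Omega> \<longrightarrow> \<bar>g y $ i - \<beta> $ i\<bar> \<le> \<epsilon>"
    using d(2)
  proof eventually_elim
    case (elim y)
    then show ?case using component_le_norm_cart[of "g y - \<beta>" i] by auto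
  qed
  with d(1) show "\<exists>\<delta>>0. AE y in lebesgue. y \<in> ball x \<delta> \<inter> \<Omega> \<longrightarrow> \<bar>g y $ i - \<beta> $ i\<bar> \<le> \<epsilon>" by blast
qed

section \<open>From vanishing density integrals to essential bounds\<close>

lemma ess_lim_zero_if_density_integrals_zero:
  assumes \<Omega>: "\<Omega> \<in> sets borel" and g: "g \<in> borel_measurable (lebesgue_on \<Omega>)"
    and int: "\<And>E. E \<in> borel_subsets \<Omega> \<Longrightarrow> (\<forall>\<delta>>0. emeasure lebesgue (ball x \<delta> \<inter> E) > 0) \<Longrightarrow>
      \<exists>\<mu>\<in>Leb_Dens \<Omega> E x. fa_has_integral \<Omega> \<mu> g 0"
    and "\<epsilon> > 0"
  shows "\<exists>\<delta>>0. AE y in lebesgue. y \<in> ball x \<delta> \<inter> \<Omega> \<longrightarrow> g y \<le> \<epsilon>"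
proof (rule ccontr)
  assume contra: "\<not> ?thesis"
  define U where "U = {y \<in> \<Omega>. g y > \<epsilon>}"
  have "U \<in> sets (lebesgue_on \<Omega>)"
    using borel_measurable_iff_greater[THEN iffD1, OF g, rule_format, of \<epsilon>]
    by (simp add: U_def space_restrict_space)
  then have U: "U \<in> sets lebesgue"
    using \<Omega> by (subst (asm) sets_restrict_space_iff) auto
  \<comment> \<open>Densities are taken within Borel sets, but \<open>U\<close> is only Lebesgue
    measurable. Its main part is Borel, and what is lost lies in a Borel null set.\<close>
  define E where "E = main_part lborel U"
  have EU: "E \<subseteq> U" and Eb: "E \<in> sets borel"
    using main_part_null_part_Un[OF U] main_part_sets[OF U] by (auto simp: E_def)
  then have E: "E \<in> borel_subsets \<Omega>" by (auto simp: borel_subsets_def U_def)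
  obtain N where N: "N \<in> null_sets lborel" "null_part lborel U \<subseteq> N"
    using null_part[OF U] by auto
  have UE: "U \<subseteq> E \<union> N"
    using main_part_null_part_Un[OF U] N(2) by (auto simp: E_def)
  \<comment> \<open>If \<open>E\<close> were null in some ball, so would be \<open>U\<close>, and
    that ball would be the one whose existence was denied.\<close>
  have pos: "emeasure lebesgue (ball x \<delta> \<inter> E) > 0" if "\<delta> > 0" for \<delta>
  proof (rule ccontr)
    assume "\<not> emeasure lebesgue (ball x \<delta> \<inter> E) > 0"
    then have "ball x \<delta> \<inter> E \<in> null_sets lebesgue"
      using Eb by (intro null_setsI) auto
    moreover have "N \<in> null_sets lebesgue" using N(1) by (rule null_sets_completionI)
    ultimately have "(ball x \<delta> \<inter> E) \<union> N \<in> null_sets lebesgue" by (rule null_sets.Un)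
    then have "AE y in lebesgue. y \<notin> (ball x \<delta> \<inter> E) \<union> N" by (rule AE_not_in)
    then have "AE y in lebesgue. y \<in> ball x \<delta> \<inter> \<Omega> \<longrightarrow> g y \<le> \<epsilon>"
      by eventually_elim (use UE in \<open>auto simp: U_def not_le\<close>)
    with contra that show False by blast
  qed
  then obtain \<mu> where \<mu>: "\<mu> \<in> Leb_Dens \<Omega> E x" "fa_has_integral \<Omega> \<mu> g 0"
    using int[OF E] by blast
  have "\<mu> E = 1" and D: "\<mu> \<in> Dens \<Omega> x"
    using Leb_Dens_self[OF \<Omega> E pos \<mu>(1)] Leb_Dens_subset_Dens[OF \<Omega> E pos \<mu>(1)] by auto
  interpret nonneg_ba \<Omega> \<mu> by (rule Dens_nonneg_ba[OF \<Omega> D])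
  have "\<mu> \<Omega> = 1" using D by (auto simp: Dens_def intro: zero_less_one)
  \<comment> \<open>\<open>fa_has_integral_pos\<close> applies to any value of the integral, in
    particular to the prescribed value 0.\<close>
  have "(0::real) < 0"
  proof (rule fa_has_integral_pos[OF \<mu>(2) \<open>\<epsilon> > 0\<close> _ E])
    show "\<mu> (\<Omega> - E) = 0" using compl[OF E] \<open>\<mu> E = 1\<close> \<open>\<mu> \<Omega> = 1\<close> by simp
    show "\<epsilon> \<le> g y" if "y \<in> E" for y using that EU by (auto simp: U_def)
  qed (use \<open>\<mu> \<Omega> = 1\<close> in simp)
  then show False by simp
qed

section \<open>Local boundedness and precise representatives near the point\<close>

lemma pr_exists_on_ball:
  fixes f :: "'a::euclidean_space \<Rightarrow> real^'m"
  assumes \<Omega>: "\<Omega> \<in> sets borel" and f: "f \<in> borel_measurable (lebesgue_on \<Omega>)"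
    and bd: "AE y in lebesgue. y \<in> ball x \<delta> \<inter> \<Omega> \<longrightarrow> norm (f y) \<le> C"
  shows "pr_exists_on \<Omega> f (ball x \<delta> \<inter> hat \<Omega>)"
  unfolding pr_exists_on_def has_pr_def
proof
  fix z assume z: "z \<in> ball x \<delta> \<inter> hat \<Omega>"
  have \<Omega>_in: "\<Omega> \<in> borel_subsets \<Omega>" using \<Omega> by (simp add: borel_subsets_def)
  obtain \<mu> where \<mu>: "\<mu> \<in> Leb_Dens \<Omega> \<Omega> z" using Leb_Dens_nonempty[OF \<Omega> \<Omega>_in] by blast
  have D: "\<mu> \<in> Dens \<Omega> z"
    using z by (intro Leb_Dens_subset_Dens[OF \<Omega> \<Omega>_in _ \<mu>] hat_ball_pos) auto
  interpret nonneg_ba \<Omega> \<mu> by (rule Dens_nonneg_ba[OF \<Omega> D])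
  \<comment> \<open>A density at \<open>z\<close> is carried by every ball around \<open>z\<close>,
    so a ball inside the region where \<open>f\<close> is bounded is all that matters.\<close>
  obtain r where r: "r > 0" "ball z r \<subseteq> ball x \<delta>"
    using z by (meson IntD1 open_ball openE)
  have B: "ball z r \<inter> \<Omega> \<in> borel_subsets \<Omega>" using \<Omega> by (auto simp: borel_subsets_def)
  have "\<Omega> - ball z r \<inter> \<Omega> = \<Omega> - ball z r" by auto
  then have B0: "\<mu> (\<Omega> - ball z r \<inter> \<Omega>) = 0" using Dens_compl_ball[OF \<Omega> D r(1)] by simp
  have "\<exists>I. fa_has_integral \<Omega> \<mu> (\<lambda>y. f y $ i) I" for i
  proof (rule fa_has_integral_bounded[OF _ B B0])
    show "(\<lambda>y. f y $ i) \<in> borel_measurable (lebesgue_on \<Omega>)"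
      by (rule measurable_compose[OF f]) (intro borel_measurable_continuous_onI continuous_intros)
    show "AE y in lebesgue. y \<in> ball z r \<inter> \<Omega> \<longrightarrow> \<bar>f y $ i\<bar> \<le> C"
      using bd
    proof eventually_elim
      case (elim y)
      then show ?case using r(2) component_le_norm_cart[of "f y" i] by auto
    qed
  qed
  then obtain I where "\<And>i. fa_has_integral \<Omega> \<mu> (\<lambda>y. f y $ i) (I i)" by metis
  then have "fa_has_vec_integral \<Omega> \<mu> f (\<chi> i. I i)"
    by (simp add: fa_has_vec_integral_def)
  with \<mu> show "\<exists>v. \<exists>\<mu>\<in>Leb_Dens \<Omega> \<Omega> z. fa_has_vec_integral \<Omega> \<mu> f v" by blast
qed

lemma L_infty_ball:
  assumes \<Omega>: "\<Omega> \<in> sets borel" and f: "f \<in> borel_measurable (lebesgue_on \<Omega>)"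
    and bd: "AE y in lebesgue. y \<in> ball x \<delta> \<inter> \<Omega> \<longrightarrow> norm (f y) \<le> C"
  shows "f \<in> L_infty (ball x \<delta> \<inter> \<Omega>)"
proof -
  have m: "f \<in> borel_measurable (lebesgue_on (ball x \<delta> \<inter> \<Omega>))"
    by (rule borel_measurable_lebesgue_on_subset[OF f]) auto
  have "AE y in lebesgue_on (ball x \<delta> \<inter> \<Omega>). ereal (norm (f y)) \<le> ereal C"
    using bd \<Omega> by (subst AE_lebesgue_on_iff) auto
  then have "esssup (lebesgue_on (ball x \<delta> \<inter> \<Omega>)) (\<lambda>y. ereal (norm (f y))) \<le> ereal C"
    using m by (intro esssup_I) auto
  also have "\<dots> < \<infinity>" by simp
  finally show ?thesis using m by (simp add: L_infty_def)
qed

section \<open>Essential derivatives\<close>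

lemma difference_quotient_measurable:
  fixes f :: "'a::euclidean_space \<Rightarrow> 'b::euclidean_space"
  assumes "f \<in> borel_measurable (lebesgue_on \<Omega>)" "linear L"
  shows "(\<lambda>y. (f y - \<alpha> - L (y - x)) /\<^sub>R norm (y - x)) \<in> borel_measurable (lebesgue_on \<Omega>)"
proof -
  have "continuous_on UNIV (\<lambda>y. L (y - x))"
    by (intro linear_continuous_on_compose[OF _ assms(2)] continuous_intros)
  then have "(\<lambda>y. L (y - x)) \<in> borel_measurable borel" by (rule borel_measurable_continuous_onI)
  then have "(\<lambda>y. L (y - x)) \<in> borel_measurable (lebesgue_on \<Omega>)"
    by (intro measurable_restrict_space1 measurable_completion) simp
  moreover have "(\<lambda>y. norm (y - x)) \<in> borel_measurable (lebesgue_on \<Omega>)"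
    by (intro measurable_restrict_space1 measurable_completion) simp
  ultimately show ?thesis using assms(1) by measurable
qed

text \<open>A quotient bounded by 1 near \<open>x\<close> together with
  \<open>norm (L v) \<le> K * norm v\<close> gives the Lipschitz type bound
  \<open>(1 + K) * norm (y - x)\<close> for \<open>f y - \<alpha>\<close>; the radius
  \<open>\<epsilon> / (1 + K)\<close> is read off from it.\<close>

lemma ess_deriv_imp_ess_lim:
  fixes f :: "'a::euclidean_space \<Rightarrow> 'b::euclidean_space"
  assumes \<Omega>: "\<Omega> \<in> sets borel" and x: "x \<in> hat \<Omega>" and f: "f \<in> borel_measurable (lebesgue_on \<Omega>)"
    and deriv: "has_ess_deriv \<Omega> f x \<alpha> L"
  shows "has_ess_lim \<Omega> f x \<alpha>"
  unfolding has_ess_lim_iff[OF \<Omega> x f]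
proof (intro allI impI)
  fix \<epsilon> :: real assume "\<epsilon> > 0"
  have L: "linear L" using deriv by (simp add: has_ess_deriv_def)
  obtain K where K: "K > 0" "\<And>v. norm (L v) \<le> K * norm v"
    using linear_bounded_pos[OF L] by (auto simp: mult.commute)
  obtain d where d: "d > 0" "AE y in lebesgue. y \<in> ball x d \<inter> \<Omega> \<longrightarrow>
      norm ((f y - \<alpha> - L (y - x)) /\<^sub>R norm (y - x) - 0) \<le> 1"
    using deriv unfolding has_ess_deriv_def
      has_ess_lim_iff[OF \<Omega> x difference_quotient_measurable[OF f L]] by (meson zero_less_one)
  define \<delta> where "\<delta> = min d (\<epsilon> / (1 + K))"
  have "\<delta> > 0" using d(1) K(1) \<open>\<epsilon> > 0\<close> by (simp add: \<delta>_def)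
  \<comment> \<open>At \<open>y = x\<close> the quotient is 0 by the division convention and says
    nothing about \<open>f x\<close>.\<close>
  have "AE y in lebesgue. y \<noteq> x"
    by (intro AE_completion AE_lborel_singleton)
  then have "AE y in lebesgue. y \<in> ball x \<delta> \<inter> \<Omega> \<longrightarrow> norm (f y - \<alpha>) \<le> \<epsilon>"
    using d(2)
  proof eventually_elim
    case (elim y)
    show ?case
    proof
      assume y: "y \<in> ball x \<delta> \<inter> \<Omega>"
      then have "norm (f y - \<alpha> - L (y - x)) \<le> norm (y - x)"
        using elim by (simp add: \<delta>_def divide_simps)
      moreover have "norm (f y - \<alpha>) \<le> norm (f y - \<alpha> - L (y - x)) + norm (L (y - x))"
        using norm_triangle_ineq[of "f y - \<alpha> - L (y - x)" "L (y - x)"] by simp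
      ultimately have "norm (f y - \<alpha>) \<le> (1 + K) * norm (y - x)"
        using K(2)[of "y - x"] by (simp add: algebra_simps)
      also have "\<dots> \<le> (1 + K) * (\<epsilon> / (1 + K))"
        using y K(1) by (intro mult_left_mono) (auto simp: \<delta>_def dist_norm norm_minus_commute)
      also have "\<dots> = \<epsilon>" using K(1) by simp
      finally show "norm (f y - \<alpha>) \<le> \<epsilon>" .
    qed
  qed
  with \<open>\<delta> > 0\<close> show "\<exists>\<delta>>0. AE y in lebesgue. y \<in> ball x \<delta> \<inter> \<Omega> \<longrightarrow> norm (f y - \<alpha>) \<le> \<epsilon>" by blast
qed

text \<open>The norm of the vector quotient is the scalar integrand, so both sides speak of the same
  nonnegative function tending essentially to 0. In the forward direction every density within
  \<open>E\<close> works, and one exists.\<close>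

lemma has_ess_deriv_iff_density_integrals:
  fixes f :: "'a::euclidean_space \<Rightarrow> 'b::euclidean_space"
  assumes \<Omega>: "\<Omega> \<in> sets borel" and x: "x \<in> hat \<Omega>" and f: "f \<in> borel_measurable (lebesgue_on \<Omega>)"
  shows "has_ess_deriv \<Omega> f x \<alpha> L \<longleftrightarrow> linear L \<and>
    (\<forall>E\<in>borel_subsets \<Omega>. (\<forall>\<delta>>0. emeasure lebesgue (ball x \<delta> \<inter> E) > 0) \<longrightarrow>
      (\<exists>\<mu>\<in>Leb_Dens \<Omega> E x. fa_has_integral \<Omega> \<mu> (\<lambda>y. norm (f y - \<alpha> - L (y - x)) / norm (y - x)) 0))"
    (is "_ \<longleftrightarrow> _ \<and> ?R")
\<comment> \<open>Linearity occurs on both sides; the case distinction makes it available for the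
  measurability of the quotient.\<close>
proof (cases "linear L")
  case L: True
  let ?q = "\<lambda>y. norm (f y - \<alpha> - L (y - x)) / norm (y - x)"
  note meas = difference_quotient_measurable[OF f L, where \<alpha> = \<alpha> and x = x]
  have q: "norm ((f y - \<alpha> - L (y - x)) /\<^sub>R norm (y - x) - 0) = ?q y" for y
    by (simp add: divide_inverse mult.commute)
  have "(\<lambda>y. norm ((f y - \<alpha> - L (y - x)) /\<^sub>R norm (y - x) - 0)) \<in> borel_measurable (lebesgue_on \<Omega>)"
    using meas by measurable
  then have q_meas: "?q \<in> borel_measurable (lebesgue_on \<Omega>)" by (simp only: q)
  have "?R" if lim: "\<forall>\<epsilon>>0. \<exists>\<delta>>0. AE y in lebesgue. y \<in> ball x \<delta> \<inter> \<Omega> \<longrightarrow> ?q y \<le> \<epsilon>"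
  proof (intro ballI impI)
    fix E assume E: "E \<in> borel_subsets \<Omega>" and pos: "\<forall>\<delta>>0. emeasure lebesgue (ball x \<delta> \<inter> E) > 0"
    obtain \<mu> where \<mu>: "\<mu> \<in> Leb_Dens \<Omega> E x" using Leb_Dens_nonempty[OF \<Omega> E] by blast
    have "fa_has_integral \<Omega> \<mu> ?q 0"
    proof (rule Dens_integral_ess_lim[OF \<Omega> Leb_Dens_subset_Dens[OF \<Omega> E _ \<mu>]])
      show "0 < emeasure lebesgue (ball x \<delta> \<inter> E)" if "\<delta> > 0" for \<delta> using pos that by blast
      show "\<exists>\<delta>>0. AE y in lebesgue. y \<in> ball x \<delta> \<inter> \<Omega> \<longrightarrow> \<bar>?q y - 0\<bar> \<le> \<epsilon>" if "\<epsilon> > 0" for \<epsilon>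
        using lim that by simp
    qed
    with \<mu> show "\<exists>\<mu>\<in>Leb_Dens \<Omega> E x. fa_has_integral \<Omega> \<mu> ?q 0" by blast
  qed
  moreover have "\<forall>\<epsilon>>0. \<exists>\<delta>>0. AE y in lebesgue. y \<in> ball x \<delta> \<inter> \<Omega> \<longrightarrow> ?q y \<le> \<epsilon>" if "?R"
    using that by (intro allI impI ess_lim_zero_if_density_integrals_zero[OF \<Omega> q_meas]) blast
  ultimately have "(\<forall>\<epsilon>>0. \<exists>\<delta>>0. AE y in lebesgue. y \<in> ball x \<delta> \<inter> \<Omega> \<longrightarrow> ?q y \<le> \<epsilon>) \<longleftrightarrow> ?R"
    by (rule iffI)
  then show ?thesis
    unfolding has_ess_deriv_def has_ess_lim_iff[OF \<Omega> x meas] q using L by simp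
qed (simp add: has_ess_deriv_def)

theorem theorem5p14:
  fixes \<Omega> :: "(real^'n) set" and x :: "real^'n"
    and f :: "real^'n \<Rightarrow> real^'m" and \<alpha> :: "real^'m"
  assumes "\<Omega> \<in> sets borel" and "x \<in> hat \<Omega>" and "f \<in> L1_loc \<Omega>"
  shows "(\<forall>L. has_ess_deriv \<Omega> f x \<alpha> L \<longleftrightarrow>
            linear L \<and>
            (\<forall>E\<in>borel_subsets \<Omega>.
               (\<forall>\<delta>>0. emeasure lebesgue (ball x \<delta> \<inter> E) > 0) \<longrightarrow>
               (\<exists>\<mu>\<in>Leb_Dens \<Omega> E x.
                  fa_has_integral \<Omega> \<mu> (\<lambda>y. norm (f y - \<alpha> - L (y - x)) / norm (y - x)) 0))) \<and>
         ((\<exists>L. has_ess_deriv \<Omega> f x \<alpha> L) \<longrightarrow>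
            has_ess_lim \<Omega> f x \<alpha> \<and>
            has_ap_lim \<Omega> f x \<alpha> \<and>
            has_pr \<Omega> f x \<alpha> \<and>
            has_fstar \<Omega> f x \<alpha> \<and>
            (\<forall>\<mu>\<in>Dens \<Omega> x. fa_has_vec_integral \<Omega> \<mu> f \<alpha>) \<and>
            (\<forall>L. has_ess_deriv \<Omega> f x \<alpha> L \<longrightarrow> has_ap_deriv \<Omega> f x \<alpha> L) \<and>
            (\<exists>\<delta>>0. f \<in> L_infty (ball x \<delta> \<inter> \<Omega>) \<and>
                   pr_exists_on \<Omega> f (ball x \<delta> \<inter> hat \<Omega>)))"
proof (intro conjI impI allI)
  have f: "f \<in> borel_measurable (lebesgue_on \<Omega>)" using assms(3) by (simp add: L1_loc_def)
  note \<Omega> = assms(1) and x = assms(2)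
  show "has_ess_deriv \<Omega> f x \<alpha> L \<longleftrightarrow> linear L \<and>
      (\<forall>E\<in>borel_subsets \<Omega>. (\<forall>\<delta>>0. emeasure lebesgue (ball x \<delta> \<inter> E) > 0) \<longrightarrow>
        (\<exists>\<mu>\<in>Leb_Dens \<Omega> E x.
          fa_has_integral \<Omega> \<mu> (\<lambda>y. norm (f y - \<alpha> - L (y - x)) / norm (y - x)) 0))" for L
    by (rule has_ess_deriv_iff_density_integrals[OF \<Omega> x f])
  show "has_ap_deriv \<Omega> f x \<alpha> L" if "has_ess_deriv \<Omega> f x \<alpha> L" for L
  proof -
    have "linear L" using that by (simp add: has_ess_deriv_def)
    then show ?thesis
      using that ess_lim_imp_ap_lim[OF \<Omega> x difference_quotient_measurable[OF f \<open>linear L\<close>]]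
      unfolding has_ap_deriv_def has_ess_deriv_def by (intro conjI) simp_all
  qed
  assume "\<exists>L. has_ess_deriv \<Omega> f x \<alpha> L"
  then show lim: "has_ess_lim \<Omega> f x \<alpha>"
    using ess_deriv_imp_ess_lim[OF \<Omega> x f] by blast
  show "has_ap_lim \<Omega> f x \<alpha>" by (rule ess_lim_imp_ap_lim[OF \<Omega> x f lim])
  show "has_fstar \<Omega> f x \<alpha>" by (rule ess_lim_imp_fstar[OF \<Omega> x f lim])
  show Dens: "\<forall>\<mu>\<in>Dens \<Omega> x. fa_has_vec_integral \<Omega> \<mu> f \<alpha>"
    using Dens_vec_integral_ess_lim[OF \<Omega> x f lim] by blast
  have \<Omega>_in: "\<Omega> \<in> borel_subsets \<Omega>" using \<Omega> by (simp add: borel_subsets_def)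
  \<comment> \<open>Here \<open>E = \<Omega>\<close>, which has positive measure in every ball
    because \<open>x \<in> hat \<Omega>\<close>; the resulting density lies in
    \<open>Dens \<Omega> x\<close>, where the integral is already known.\<close>
  then obtain \<mu> where \<mu>: "\<mu> \<in> Leb_Dens \<Omega> \<Omega> x" using Leb_Dens_nonempty[OF \<Omega>] by blast
  have "\<mu> \<in> Dens \<Omega> x" by (rule Leb_Dens_subset_Dens[OF \<Omega> \<Omega>_in hat_ball_pos[OF x] \<mu>])
  with \<mu> Dens show "has_pr \<Omega> f x \<alpha>" unfolding has_pr_def by blast
  \<comment> \<open>The bound 1 is arbitrary: any finite bound around \<open>\<alpha>\<close> yields
    a radius that serves both for boundedness and for the existence of \<open>pr f\<close>.\<close>
  obtain \<delta> where \<delta>: "\<delta> > 0" "AE y in lebesgue. y \<in> ball x \<delta> \<inter> \<Omega> \<longrightarrow> norm (f y - \<alpha>) \<le> 1"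
    using lim unfolding has_ess_lim_iff[OF \<Omega> x f] by (meson zero_less_one)
  have bd: "AE y in lebesgue. y \<in> ball x \<delta> \<inter> \<Omega> \<longrightarrow> norm (f y) \<le> norm \<alpha> + 1"
    using \<delta>(2)
  proof eventually_elim
    case (elim y)
    then show ?case using norm_triangle_ineq2[of "f y" \<alpha>] by auto
  qed
  show "\<exists>\<delta>>0. f \<in> L_infty (ball x \<delta> \<inter> \<Omega>) \<and> pr_exists_on \<Omega> f (ball x \<delta> \<inter> hat \<Omega>)"
    using \<delta>(1) L_infty_ball[OF \<Omega> f bd] pr_exists_on_ball[OF \<Omega> f bd] by blast
qed

end
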